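(* Let $n$ be a positive integer, $\alpha,\beta>-1$ real, $\delta>0$, and $\nu\in\mathbb{C}$ with $\operatorname{Re}\nu<n$. Let $f:\mathbb{R}\to\mathbb{C}$ be continuous and absolutely integrable with $f(x)=O(x^{\operatorname{Re}\nu-n-\varepsilon})$ as $x\to\infty$ for some $\varepsilon>0$, and suppose that the approximate fractional Jacobi derivative $g:=W_{\delta,\alpha,\beta}^{\nu,n}[f]$ is absolutely integrable. Let $F$ and $G$ be the Fourier transforms of $f$ and $g$. Then for every real $\omega\neq0$ one has $G(\omega)=H_\delta^\nu(\omega)F(\omega)$ with transfer function $$H_\delta^\nu(\omega)=(i\omega)^\nu\,e^{-i\omega\delta}\,M\big(n+\alpha+1,\;2n+\alpha+\beta+2;\;2i\omega\delta\big).$$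
   Context: $M(a,c;z)=\sum_{k\ge0}\frac{(a)_k}{(c)_k}\frac{z^k}{k!}$ is the confluent hypergeometric (Kummer) function. Fourier transform: $F(\omega)=\frac{1}{\sqrt{2\pi}}\int_{-\infty}^\infty e^{i\omega x}f(x)\,dx$, and likewise for $G$. Powers: $z^\nu=e^{\nu\ln z}$ with $-\pi<\arg z<\pi$; in particular $(i\omega)^\nu=e^{\nu(\ln|\omega|+i\pi\,\mathrm{sgn}(\omega)/2)}$ for real $\omega\ne0$. Weyl fractional integral ($\operatorname{Re}\lambda>0$): $W^{-\lambda}[f](x)=\frac{1}{\Gamma(\lambda)}\int_x^\infty f(y)(y-x)^{\lambda-1}dy$. Let $P_n^{(\alpha,\beta)}$ be the Jacobi polynomial, $k_n$ its leading coefficient, and $h_n=\int_{-1}^1P_n^{(\alpha,\beta)}(\xi)^2(1-\xi)^\alpha(1+\xi)^\beta d\xi$. Put $$D_{\delta,\alpha,\beta}^n[g](x)=\frac{k_n\,n!}{h_n}\frac{1}{\delta^n}\int_{-1}^{1}g(x+\delta\xi)P_n^{(\alpha,\beta)}(\xi)(1-\xi)^\alpha(1+\xi)^\beta d\xi .$$ The approximate fractional Jacobi derivative is $W_{\delta,\alpha,\beta}^{\nu,n}[f](x)=(-1)^nD_{\delta,\alpha,\beta}^n\big[W^{\nu-n}[f]\big](x)$ for $\operatorname{Re}\nu<n$. *)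

theory Defs
  imports "HOL-Analysis.Analysis" "HOL-Library.Landau_Symbols"
begin

definition kummer_M :: "complex \<Rightarrow> complex \<Rightarrow> complex \<Rightarrow> complex" where
  "kummer_M a c z = (\<Sum>k. pochhammer a k / pochhammer c k * z ^ k / fact k)"

text \<open>The kernel has a plus sign in the exponent and the unitary normalisation.\<close>

definition fourier_transform :: "(real \<Rightarrow> complex) \<Rightarrow> real \<Rightarrow> complex" where
  "fourier_transform f \<omega> =
     1 / complex_of_real (sqrt (2 * pi)) * (LBINT x. exp (\<i> * of_real (\<omega> * x)) * f x)"

text \<open>\<open>weyl_integral l\<close> is the operator \<open>W\<close> with upper index \<open>- l\<close>, for \<open>Re l > 0\<close>.\<close>

definition weyl_integral :: "complex \<Rightarrow> (real \<Rightarrow> complex) \<Rightarrow> real \<Rightarrow> complex" where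
  "weyl_integral l f x =
     1 / Gamma l * (LBINT y:{x<..}. f y * complex_of_real (y - x) powr (l - 1))"

text \<open>Jacobi polynomials in Szego's form (4.3.2), equivalently DLMF 18.5.8.\<close>

definition jacobi_poly :: "real \<Rightarrow> real \<Rightarrow> nat \<Rightarrow> real poly" where
  "jacobi_poly \<alpha> \<beta> n =
     (\<Sum>s\<le>n. smult (((real n + \<alpha>) gchoose (n - s)) * ((real n + \<beta>) gchoose s))
               ([:- 1 / 2, 1 / 2:] ^ s * [:1 / 2, 1 / 2:] ^ (n - s)))"

definition jacobi_weight :: "real \<Rightarrow> real \<Rightarrow> real \<Rightarrow> real" where
  "jacobi_weight \<alpha> \<beta> \<xi> = (1 - \<xi>) powr \<alpha> * (1 + \<xi>) powr \<beta>"

definition jacobi_norm :: "real \<Rightarrow> real \<Rightarrow> nat \<Rightarrow> real" where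
  "jacobi_norm \<alpha> \<beta> n =
     (LBINT \<xi>:{-1..1}. (poly (jacobi_poly \<alpha> \<beta> n) \<xi>)\<^sup>2 * jacobi_weight \<alpha> \<beta> \<xi>)"

definition approx_jacobi_deriv ::
  "real \<Rightarrow> real \<Rightarrow> real \<Rightarrow> nat \<Rightarrow> (real \<Rightarrow> complex) \<Rightarrow> real \<Rightarrow> complex" where
  "approx_jacobi_deriv \<delta> \<alpha> \<beta> n g x =
     of_real (lead_coeff (jacobi_poly \<alpha> \<beta> n) * fact n / jacobi_norm \<alpha> \<beta> n * (1 / \<delta> ^ n)) *
     (LBINT \<xi>:{-1..1}. g (x + \<delta> * \<xi>) *
        of_real (poly (jacobi_poly \<alpha> \<beta> n) \<xi> * jacobi_weight \<alpha> \<beta> \<xi>))"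

definition approx_frac_jacobi_deriv ::
  "real \<Rightarrow> real \<Rightarrow> real \<Rightarrow> complex \<Rightarrow> nat \<Rightarrow> (real \<Rightarrow> complex) \<Rightarrow> real \<Rightarrow> complex" where
  "approx_frac_jacobi_deriv \<delta> \<alpha> \<beta> \<nu> n f x =
     (- 1) ^ n * approx_jacobi_deriv \<delta> \<alpha> \<beta> n (weyl_integral (of_nat n - \<nu>) f) x"

definition jacobi_transfer ::
  "real \<Rightarrow> real \<Rightarrow> real \<Rightarrow> complex \<Rightarrow> nat \<Rightarrow> real \<Rightarrow> complex" where
  "jacobi_transfer \<delta> \<alpha> \<beta> \<nu> n \<omega> =
     (\<i> * of_real \<omega>) powr \<nu> * exp (- \<i> * of_real (\<omega> * \<delta>)) *
     kummer_M (of_real (real n + \<alpha> + 1)) (of_real (2 * real n + \<alpha> + \<beta> + 2))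
              (2 * \<i> * of_real (\<omega> * \<delta>))"

end

(* Abbreviate l = n - nu and let Q be the Jacobi weight times the Jacobi polynomial, normalised, so that
   g(x) = \<integral>\<integral> Q(\<xi>) f(y) k(y - x - \<delta> \<xi>) dy d\<xi> with k(s) = s^(l-1) / \<Gamma>(l) on s > 0. Formally the transform of g is
   the product of the Laplace transform p^(-l) of k at p = i\<omega>, of the transform of f and of that of Q.
   Since k is not integrable, no Fubini theorem applies directly. We multiply g by the damping factor
   (1 - i\<theta>\<omega>x)^(-N), which is the average of e^(i\<theta>\<omega>tx) over the Gamma density in t > 0. The damped integral
   converges absolutely and equals the average of the conjectured product over the frequencies \<omega>(1 + \<theta>t). These
   all lie at least as far from the singularity 0 as \<omega> does, so dominated convergence applies as \<theta> \<rightarrow> 0.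
   The transform of Q is found from the moments of the Jacobi polynomial on [0,1], which are n-th finite
   differences of Pochhammer symbols: the first n vanish and the others give the Kummer series. *)

theory Submission
  imports Defs "HOL-Complex_Analysis.Cauchy_Integral_Theorem"
begin

section \<open>The Laplace transform of the Weyl kernel\<close>

text \<open>The shape of the damping factor is dictated by the singularity of p^(-l) at p = 0. A
  Gaussian or a factor e^(-\<eta>|x|) would average over frequencies on both sides of \<omega>,
  hence across 0, where |p|^(-Re l) is not even integrable once Re l \<ge> 1. The Gamma density
  lives on t > 0 and its scale \<theta>\<omega> carries the sign of \<omega>, so the average runs
  outwards only. The order N answers the growth of k: for Re l > 1 the kernel grows like s^(Re l -
  1), and the damping must absorb this power and leave two more for integrability in s. The result
  may still grow like z^(Re l - 1) to the right, which is paid for by the decay of f. To the left f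
  is merely integrable, which is why the weights contain max y 0 and not |y|. A second
  regularisation sits inside the first: the damped kernel is absolutely integrable in s, but after
  the damping is written as an average over t the double integral in (s, t) is not, since k itself
  is not integrable.\<close>

lemma exp_series_integral:
  fixes \<phi> :: "real \<Rightarrow> complex" and z :: complex
  assumes int: "integrable lborel (\<lambda>x. exp (of_real (norm z * \<bar>x\<bar>)) * \<phi> x)"
    and meas [measurable]: "\<phi> \<in> borel_measurable borel"
  shows "integrable lborel (\<lambda>x. exp (z * of_real x) * \<phi> x)"
    and "(\<lambda>k. z ^ k / fact k * (LBINT x. of_real x ^ k * \<phi> x)) sums (LBINT x. exp (z * of_real x) * \<phi> x)"
proof -
  let ?w = "\<lambda>x. norm (exp (of_real (norm z * \<bar>x\<bar>)) * \<phi> x)"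
  let ?s = "\<lambda>n x. (\<Sum>k<n. (z * of_real x) ^ k /\<^sub>R fact k) * \<phi> x"
  have w: "integrable lborel ?w" using int by (rule integrable_norm)
  \<comment> \<open>One majorant \<open>?w\<close> serves all partial sums, so a single dominated
    convergence yields both the integrability of the limit and the termwise integration.\<close>
  have bnd: "norm (?s n x) \<le> ?w x" for n x
  proof -
    have "norm (\<Sum>k<n. (z * of_real x) ^ k /\<^sub>R fact k) \<le> (\<Sum>k<n. (norm z * \<bar>x\<bar>) ^ k /\<^sub>R fact k)"
      by (rule order_trans[OF norm_sum]) (simp add: norm_power norm_mult)
    also have "\<dots> \<le> exp (norm z * \<bar>x\<bar>)"
      unfolding exp_def by (rule sum_le_suminf[OF summable_exp_generic]) auto
    finally show ?thesis
      by (simp add: norm_mult norm_exp_eq_Re mult_right_mono)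
  qed
  have lim: "(\<lambda>n. ?s n x) \<longlonglongrightarrow> exp (z * of_real x) * \<phi> x" for x
    by (intro tendsto_mult tendsto_const exp_converges[unfolded sums_def])
  have meas_s: "?s n \<in> borel_measurable lborel" for n
    by simp
  have meas_f: "(\<lambda>x. exp (z * of_real x) * \<phi> x) \<in> borel_measurable lborel"
    by simp
  note dct = meas_f meas_s w AE_I2[OF lim] AE_I2[OF bnd]
  show "integrable lborel (\<lambda>x. exp (z * of_real x) * \<phi> x)"
    by (rule integrable_dominated_convergence[OF dct])
  \<comment> \<open>A single term is the difference of two consecutive partial sums, and these are
    integrable by domination.\<close>
  have int_k: "integrable lborel (\<lambda>x. z ^ k / fact k * (of_real x ^ k * \<phi> x))" for k
  proof -
    have "integrable lborel (\<lambda>x. ?s (Suc k) x - ?s k x)"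
      by (intro Bochner_Integration.integrable_diff integrable_dominated_convergence2[OF dct])
    then show ?thesis
      by (rule Bochner_Integration.integrable_cong[THEN iffD1, rotated 2])
        (auto simp: scaleR_conv_of_real field_simps power_mult_distrib)
  qed
  have "(\<lambda>n. LBINT x. ?s n x) \<longlonglongrightarrow> (LBINT x. exp (z * of_real x) * \<phi> x)"
    by (rule integral_dominated_convergence[OF dct])
  moreover have "(LBINT x. ?s n x) = (\<Sum>k<n. z ^ k / fact k * (LBINT x. of_real x ^ k * \<phi> x))" for n
  proof -
    have "(LBINT x. ?s n x) = (LBINT x. (\<Sum>k<n. z ^ k / fact k * (of_real x ^ k * \<phi> x)))"
      by (intro Bochner_Integration.integral_cong)
        (auto simp: sum_distrib_left scaleR_conv_of_real mult.assoc divide_inverse mult_ac power_mult_distrib)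
    also have "\<dots> = (\<Sum>k<n. LBINT x. z ^ k / fact k * (of_real x ^ k * \<phi> x))"
      by (rule Bochner_Integration.integral_sum) (rule int_k)
    finally show ?thesis by simp
  qed
  ultimately show "(\<lambda>k. z ^ k / fact k * (LBINT x. of_real x ^ k * \<phi> x)) sums (LBINT x. exp (z * of_real x) * \<phi> x)"
    unfolding sums_def by simp
qed

text \<open>The extension by 0 to s \<le> 0 turns the Weyl integral over y > x into an integral over
  the whole line against \<open>weyl_kernel l (y - x)\<close>.\<close>

definition weyl_kernel :: "complex \<Rightarrow> real \<Rightarrow> complex" where
  "weyl_kernel l s = (if 0 < s then of_real s powr (l - 1) / Gamma l else 0)"

lemma weyl_kernel_measurable [measurable]: "weyl_kernel l \<in> borel_measurable borel"
  unfolding weyl_kernel_def by measurable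

lemma norm_weyl_kernel: "norm (weyl_kernel l s) = (if 0 < s then s powr (Re l - 1) / norm (Gamma l) else 0)"
  by (auto simp: weyl_kernel_def norm_divide norm_powr_real_powr)

text \<open>For r = 1 this is Euler's integral for \<open>Gamma l\<close>. The general case is the
  substitution s \<rightarrow> r s, under which the kernel is homogeneous of degree l - 1.\<close>

lemma weyl_kernel_Laplace_real:
  assumes l: "Re l > 0" and r: "(r::real) > 0"
  shows "has_bochner_integral lborel (\<lambda>s. weyl_kernel l s * exp (- of_real (r * s))) (of_real r powr - l)"
proof -
  let ?f = "\<lambda>t. complex_of_real t powr (l - 1) / of_real (exp t)"
  have G: "Gamma l \<noteq> 0" using l by (auto simp: Gamma_eq_zero_iff elim!: nonpos_Ints_cases)
  have eq: "(\<lambda>t. indicator {0<..} t *\<^sub>R ?f t) = (\<lambda>s. Gamma l * (weyl_kernel l s * exp (- of_real s)))"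
    using G by (auto simp: fun_eq_iff weyl_kernel_def indicator_def exp_minus field_simps exp_of_real)
  have "set_integrable lborel {0<..} ?f"
    using absolutely_integrable_Gamma_integral'[OF l]
    unfolding set_integrable_def eq by (subst (asm) integrable_completion) auto
  then have 1: "has_bochner_integral lborel (\<lambda>s. weyl_kernel l s * exp (- of_real s)) 1"
  proof -
    assume int: "set_integrable lborel {0<..} ?f"
    then have "(LBINT t:{0<..}. ?f t) = integral {0<..} ?f"
      by (rule set_borel_integral_eq_integral)
    also have "\<dots> = Gamma l"
      using Gamma_integral_complex'[OF l] by (rule integral_unique)
    finally have "has_bochner_integral lborel (\<lambda>t. indicator {0<..} t *\<^sub>R ?f t) (Gamma l)"
      using int by (simp add: has_bochner_integral_iff set_integrable_def set_lebesgue_integral_def)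
    then have "has_bochner_integral lborel (\<lambda>t. inverse (Gamma l) * (indicator {0<..} t *\<^sub>R ?f t)) (inverse (Gamma l) * Gamma l)"
      by (rule has_bochner_integral_mult_right)
    then show ?thesis
      unfolding fun_cong[OF eq] using G by (simp flip: mult.assoc)
  qed
  have "has_bochner_integral lborel (\<lambda>s. weyl_kernel l (0 + r * s) * exp (- of_real (0 + r * s))) (1 /\<^sub>R \<bar>r\<bar>)"
    using lborel_has_bochner_integral_real_affine_iff[of r "\<lambda>s. weyl_kernel l s * exp (- of_real s)" 1 0] 1 r by simp
  then have "has_bochner_integral lborel (\<lambda>s. of_real r powr (1 - l) * (weyl_kernel l (0 + r * s) * exp (- of_real (0 + r * s))))
     (of_real r powr (1 - l) * (1 /\<^sub>R \<bar>r\<bar>))"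
    by (rule has_bochner_integral_mult_right)
  moreover have "of_real r powr (1 - l) * (1 /\<^sub>R \<bar>r\<bar>) = of_real r powr - l"
    using r by (simp add: powr_diff scaleR_conv_of_real powr_minus field_simps)
  moreover have "of_real r powr (1 - l) * weyl_kernel l (0 + r * s) = weyl_kernel l s" for s
  proof -
    have "of_real r powr (1 - l) * (complex_of_real r powr (l - 1)) = 1"
      using r by (subst powr_add[symmetric]) auto
    then show ?thesis
      using r by (auto simp: weyl_kernel_def powr_times_real zero_less_mult_iff)
  qed
  ultimately show ?thesis by (simp flip: mult.assoc)
qed

lemma weyl_kernel_Laplace:
  assumes l: "Re l > 0" and p: "Re p > 0"
  shows "has_bochner_integral lborel (\<lambda>s. weyl_kernel l s * exp (- (p * of_real s))) (p powr - l)"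
proof -
  \<comment> \<open>Write p = r - z with |z| < r, possible for large real r, and expand e^(zs): this reduces to p = r and the binomial series.\<close>
  define r where "r = (norm p)\<^sup>2 / Re p"
  have p0: "p \<noteq> 0" using p by auto
  have r: "r > 0" using p p0 by (simp add: r_def)
  define z where "z = of_real r - p"
  \<comment> \<open>The value of r makes 2 r Re p equal to 2 |p|^2, so that |z|^2 = r^2 - |p|^2
    falls below r^2.\<close>
  have "(norm z)\<^sup>2 = r\<^sup>2 - 2 * r * Re p + (norm p)\<^sup>2"
    unfolding z_def cmod_power2 by (simp add: power2_eq_square algebra_simps)
  also have "\<dots> = r\<^sup>2 - (norm p)\<^sup>2"
    using p by (simp add: r_def field_simps)
  also have "\<dots> < r\<^sup>2" using p0 by simp
  finally have z: "norm z < r" using r by (simp add: power2_less_imp_less)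
  let ?\<phi> = "\<lambda>s. weyl_kernel l s * exp (- of_real (r * s))"
  have "integrable lborel (\<lambda>s. weyl_kernel l s * exp (- of_real ((r - norm z) * s)))"
    using weyl_kernel_Laplace_real[OF l, of "r - norm z"] z by (simp add: has_bochner_integral_iff)
  moreover have "weyl_kernel l s * exp (- of_real ((r - norm z) * s)) =
      exp (of_real (norm z * \<bar>s\<bar>)) * ?\<phi> s" for s
  proof (cases "s > 0")
    case True
    then show ?thesis by (simp add: algebra_simps flip: exp_add)
  qed (simp add: weyl_kernel_def)
  ultimately have "integrable lborel (\<lambda>s. exp (of_real (norm z * \<bar>s\<bar>)) * ?\<phi> s)" by (simp only:)
  moreover have "?\<phi> \<in> borel_measurable borel" by measurable
  ultimately have ser: "integrable lborel (\<lambda>s. exp (z * of_real s) * ?\<phi> s)"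
    "(\<lambda>k. z ^ k / fact k * (LBINT s. of_real s ^ k * ?\<phi> s)) sums (LBINT s. exp (z * of_real s) * ?\<phi> s)"
    by (rule exp_series_integral)+
  \<comment> \<open>The factor s^k turns the kernel of order l into a multiple of the kernel of
    order l + k, so each moment is again a Laplace transform at the real point r.\<close>
  have mom: "(LBINT s. of_real s ^ k * ?\<phi> s) = pochhammer l k * of_real r powr - (l + of_nat k)" for k
  proof -
    have lk: "Re (l + of_nat k) > 0" using l by simp
    have ln: "l \<notin> \<int>\<^sub>\<le>\<^sub>0" using l by (auto elim!: nonpos_Ints_cases)
    have G: "Gamma l \<noteq> 0" "Gamma (l + of_nat k) \<noteq> 0"
      using l lk by (auto simp: Gamma_eq_zero_iff elim!: nonpos_Ints_cases dest!: arg_cong[where f=Re])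
    have *: "of_real s ^ k * ?\<phi> s = pochhammer l k * (weyl_kernel (l + of_nat k) s * exp (- of_real (r * s)))" for s
      using G ln by (auto simp: weyl_kernel_def pochhammer_Gamma powr_add powr_diff powr_nat' field_simps)
    show ?thesis
      unfolding * using weyl_kernel_Laplace_real[OF lk r] by (simp add: has_bochner_integral_iff)
  qed
  \<comment> \<open>Binomial series of (1 - z/r)^(-l), where p = r (1 - z/r). The principal powers
    multiply without a branch correction because r is a positive real.\<close>
  have "(\<lambda>k. z ^ k / fact k * (LBINT s. of_real s ^ k * ?\<phi> s)) sums (p powr - l)"
  proof -
    have "norm (- z / of_real r) < 1" using z r by (simp add: norm_divide)
    from gen_binomial_complex[OF this, of "- l"]
    have "(\<lambda>k. of_real r powr - l * ((- l gchoose k) * (- z / of_real r) ^ k)) sums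
        (of_real r powr - l * (1 + - z / of_real r) powr - l)" by (rule sums_mult)
    also have "of_real r powr - l * (1 + - z / of_real r) powr - l = (of_real r * (1 + - z / of_real r)) powr - l"
      using r by (simp add: powr_times_real_left)
    also have "of_real r * (1 + - z / of_real r) = p"
      using r by (simp add: z_def field_simps)
    also have "(\<lambda>k. of_real r powr - l * ((- l gchoose k) * (- z / of_real r) ^ k)) =
       (\<lambda>k. z ^ k / fact k * (LBINT s. of_real s ^ k * ?\<phi> s))"
    proof
      fix k
      show "of_real r powr - l * ((- l gchoose k) * (- z / of_real r) ^ k) =
          z ^ k / fact k * (LBINT s. of_real s ^ k * ?\<phi> s)"
      proof -
        have "(- z / of_real r) ^ k * (- 1) ^ k = (z / of_real r) ^ k"
          by (simp flip: power_mult_distrib)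
        then have "of_real r powr - l * ((- l gchoose k) * (- z / of_real r) ^ k) =
            of_real r powr - l * (pochhammer l k / fact k * (z / of_real r) ^ k)"
          by (simp add: gbinomial_pochhammer algebra_simps)
        then show ?thesis
          unfolding mom using r by (simp add: powr_diff powr_nat' power_divide)
      qed
    qed
    finally show ?thesis .
  qed
  then have "(LBINT s. exp (z * of_real s) * ?\<phi> s) = p powr - l"
    using ser(2) sums_unique2 by simp blast
  moreover have *: "exp (z * of_real s) * ?\<phi> s = weyl_kernel l s * exp (- (p * of_real s))" for s
    by (simp add: z_def algebra_simps exp_diff exp_minus field_simps flip: exp_add)
  ultimately show ?thesis
    using ser(1) unfolding has_bochner_integral_iff * by blast
qed

section \<open>The transform of the Jacobi kernel\<close>

text \<open>Pascal's rule, read as the recursion that builds a difference of order n + 1 from those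
  of order n of \<open>h\<close> and of its shift.\<close>

lemma alternating_binomial_sum_Suc:
  fixes h :: "nat \<Rightarrow> 'a :: comm_ring_1"
  shows "(\<Sum>s\<le>Suc n. (- 1) ^ s * of_nat (Suc n choose s) * h s) =
    (\<Sum>s\<le>n. (- 1) ^ s * of_nat (n choose s) * h s) - (\<Sum>s\<le>n. (- 1) ^ s * of_nat (n choose s) * h (Suc s))"
proof -
  have "(\<Sum>s\<le>Suc n. (- 1) ^ s * of_nat (Suc n choose s) * h s) =
      h 0 + (\<Sum>s\<le>n. (- 1) ^ Suc s * of_nat (n choose Suc s) * h (Suc s))
      - (\<Sum>s\<le>n. (- 1) ^ s * of_nat (n choose s) * h (Suc s))"
    by (subst sum.atMost_Suc_shift) (simp add: algebra_simps sum.distrib sum_negf sum_subtractf)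
  \<comment> \<open>The range on the right may run to \<open>Suc n\<close>, since
    \<open>n choose Suc n\<close> is 0.\<close>
  also have "h 0 + (\<Sum>s\<le>n. (- 1) ^ Suc s * of_nat (n choose Suc s) * h (Suc s)) =
      (\<Sum>s\<le>Suc n. (- 1) ^ s * of_nat (n choose s) * h s)"
    by (subst sum.atMost_Suc_shift) simp
  finally show ?thesis by (simp add: binomial_eq_0 del: binomial_Suc_Suc)
qed

text \<open>The discrete analogue of differentiating a power: one difference in the base shortens a
  Pochhammer symbol by one factor, brings down its length and shifts the base by 1. The shift is the
  reason why the induction has to be arbitrary in \<open>x\<close>.\<close>

lemma alternating_binomial_sum_pochhammer:
  fixes x :: "'a :: field_char_0"
  shows "(\<Sum>s\<le>n. (- 1) ^ s * of_nat (n choose s) * pochhammer (x + of_nat s) k) =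
    (if k < n then 0 else (- 1) ^ n * fact k / fact (k - n) * pochhammer (x + of_nat n) (k - n))"
proof (induction n arbitrary: x)
  case (Suc n)
  have "(\<Sum>s\<le>Suc n. (- 1) ^ s * of_nat (Suc n choose s) * pochhammer (x + of_nat s) k) =
    (\<Sum>s\<le>n. (- 1) ^ s * of_nat (n choose s) * pochhammer (x + of_nat s) k) -
    (\<Sum>s\<le>n. (- 1) ^ s * of_nat (n choose s) * pochhammer (x + 1 + of_nat s) k)"
    by (subst alternating_binomial_sum_Suc) (simp add: algebra_simps)
  also have "\<dots> = (if k < Suc n then 0 else (- 1) ^ Suc n * fact k / fact (k - Suc n) * pochhammer (x + of_nat (Suc n)) (k - Suc n))"
  proof (cases "k > n")
    case True
    define i where "i = k - Suc n"
    have k: "k - n = Suc i" "k - Suc n = i" using True by (auto simp: i_def)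
    have "pochhammer y (Suc i) - pochhammer (y + 1) (Suc i) = - of_nat (Suc i) * pochhammer (y + 1) i" for y :: 'a
      by (subst pochhammer_rec, subst pochhammer_Suc) (simp add: algebra_simps)
    from this[of "x + of_nat n"]
    have *: "pochhammer (x + of_nat n) (Suc i) - pochhammer (x + 1 + of_nat n) (Suc i) = - of_nat (Suc i) * pochhammer (x + 1 + of_nat n) i"
      by (simp add: algebra_simps)
    have "(- 1) ^ n * fact k / fact (Suc i) * pochhammer (x + of_nat n) (Suc i) - (- 1) ^ n * fact k / fact (Suc i) * pochhammer (x + 1 + of_nat n) (Suc i)
       = (- 1) ^ n * fact k / fact (Suc i) * (- of_nat (Suc i) * pochhammer (x + 1 + of_nat n) i)"
      unfolding * [symmetric] by (simp only: right_diff_distrib)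
    also have "\<dots> = (- 1) ^ Suc n * fact k / fact i * pochhammer (x + 1 + of_nat n) i"
      by (simp add: fact_Suc divide_simps del: of_nat_Suc)
    finally show ?thesis
      using True unfolding Suc.IH k by (simp add: k algebra_simps)
  next
    case False
    \<comment> \<open>In the boundary case k = n both differences of order n are the same constant,
      and they cancel.\<close>
    then show ?thesis unfolding Suc.IH by auto
  qed
  finally show ?case .
qed simp

section \<open>Moments of the Jacobi polynomial on [0,1]\<close>

text \<open>With \<xi> = 1 - 2t the two linear factors become -t and 1 - t, so that every summand
  times the transported weight is the integrand of a Beta function.\<close>

lemma poly_jacobi_reflect:
  "poly (jacobi_poly \<alpha> \<beta> n) (1 - 2 * t) =
     (\<Sum>s\<le>n. (- 1) ^ s * ((real n + \<alpha>) gchoose (n - s)) * ((real n + \<beta>) gchoose s) * t ^ s * (1 - t) ^ (n - s))"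
proof -
  have "poly (jacobi_poly \<alpha> \<beta> n) (1 - 2 * t) =
     (\<Sum>s\<le>n. ((real n + \<alpha>) gchoose (n - s)) * ((real n + \<beta>) gchoose s) * ((- t) ^ s * (1 - t) ^ (n - s)))"
  proof -
    have "poly [:- 1 / 2, 1 / 2:] (1 - 2 * t) = - t" "poly [:1 / 2, 1 / 2:] (1 - 2 * t) = 1 - t"
      by (simp_all add: field_simps)
    then show ?thesis by (simp only: jacobi_poly_def poly_sum poly_smult poly_mult poly_power)
  qed
  then show ?thesis by (simp add: power_minus[of t] mult_ac)
qed

text \<open>In this form the coefficients are visibly positive for \<open>\<alpha>\<close>,
  \<open>\<beta>\<close> > -1, and they extend the Gamma factors of the Beta integrals to values
  free of s, for instance Gamma(\<alpha>+s+1) to Gamma(n+\<alpha>+1).\<close>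

lemma jacobi_coefficient:
  assumes "s \<le> n"
  shows "((real n + \<alpha>) gchoose (n - s)) = pochhammer (\<alpha> + real s + 1) (n - s) / fact (n - s)"
    and "((real n + \<beta>) gchoose s) = pochhammer (\<beta> + real (n - s) + 1) s / fact s"
  using assms by (auto simp: gbinomial_pochhammer' of_nat_diff algebra_simps)

text \<open>All summands have degree n and the same leading coefficient 2^(-n), and they enter with
  positive weights; hence no cancellation can lower the degree.\<close>

lemma
  assumes \<alpha>: "\<alpha> > -1" and \<beta>: "\<beta> > -1"
  shows degree_jacobi_poly: "degree (jacobi_poly \<alpha> \<beta> n) = n"
    and lead_coeff_jacobi_poly_pos: "lead_coeff (jacobi_poly \<alpha> \<beta> n) > 0"
proof -
  let ?q = "\<lambda>s. [:- 1 / 2, 1 / 2:] ^ s * [:1 / 2, 1 / 2 :: real:] ^ (n - s)"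
  have deg: "degree (?q s) = n" and lc: "lead_coeff (?q s) = (1 / 2) ^ n" if "s \<le> n" for s
  proof -
    show "degree (?q s) = n"
      using that by (simp add: degree_mult_eq degree_power_eq)
    show "lead_coeff (?q s) = (1 / 2) ^ n"
      using that unfolding lead_coeff_mult lead_coeff_power by (simp flip: power_add)
  qed
  have "coeff (jacobi_poly \<alpha> \<beta> n) n =
      (\<Sum>s\<le>n. ((real n + \<alpha>) gchoose (n - s)) * ((real n + \<beta>) gchoose s) * (1 / 2) ^ n)"
    unfolding jacobi_poly_def coeff_sum coeff_smult
  proof (intro sum.cong refl)
    fix s assume "s \<in> {..n}"
    then have s: "s \<le> n" by simp
    show "((real n + \<alpha>) gchoose (n - s)) * ((real n + \<beta>) gchoose s) * coeff (?q s) n =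
      ((real n + \<alpha>) gchoose (n - s)) * ((real n + \<beta>) gchoose s) * (1 / 2) ^ n"
      using lc[OF s] unfolding deg[OF s] by simp
  qed
  also have "\<dots> > 0"
    using \<alpha> \<beta> by (intro sum_pos mult_pos_pos) (auto simp: jacobi_coefficient intro!: pochhammer_pos divide_pos_pos)
  finally have pos: "coeff (jacobi_poly \<alpha> \<beta> n) n > 0" .
  have "degree (jacobi_poly \<alpha> \<beta> n) \<le> n"
    unfolding jacobi_poly_def
    by (intro degree_sum_le finite_atMost order_trans[OF degree_smult_le] eq_refl[OF deg]) (simp only: atMost_iff)
  with pos show "degree (jacobi_poly \<alpha> \<beta> n) = n"
    by (metis le_antisym le_degree less_irrefl)
  with pos show "lead_coeff (jacobi_poly \<alpha> \<beta> n) > 0" by simp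
qed

text \<open>Jacobi polynomial times weight, pulled back along \<xi> = 1 - 2t: the end \<xi> = 1,
  with exponent \<alpha>, moves to t = 0. The powers of 2 from the weight are left out and return in
  \<open>jacobi_kernel_reflect\<close>.\<close>

definition unit_jacobi :: "real \<Rightarrow> real \<Rightarrow> nat \<Rightarrow> real \<Rightarrow> real" where
  "unit_jacobi \<alpha> \<beta> n t = indicator {0..1} t * (poly (jacobi_poly \<alpha> \<beta> n) (1 - 2 * t) * (t powr \<alpha> * (1 - t) powr \<beta>))"

lemma has_bochner_integral_Beta:
  assumes "a > 0" "b > (0::real)"
  shows "has_bochner_integral lborel (\<lambda>t. indicator {0..1} t * (t powr (a - 1) * (1 - t) powr (b - 1))) (Beta a b)"
proof -
  note int = integrable_Beta[OF assms]
  have "(LBINT t:{0..1}. t powr (a - 1) * (1 - t) powr (b - 1)) = Beta a b"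
    using set_borel_integral_eq_integral(2)[OF int] integral_unique[OF has_integral_Beta_real[OF assms]] by simp
  with int show ?thesis
    by (simp add: has_bochner_integral_iff set_integrable_def set_lebesgue_integral_def)
qed

text \<open>The Beta integrals of all summands share the denominator Gamma(k+n+\<alpha>+\<beta>+2).
  What still depends on s is the binomial coefficient times (\<alpha>+1+s)_k, so the sum is an n-th
  difference. Its vanishing for k < n is the orthogonality of the Jacobi polynomial to lower
  degrees.\<close>

lemma unit_jacobi_moment:
  assumes \<alpha>: "\<alpha> > -1" and \<beta>: "\<beta> > -1"
  shows "has_bochner_integral lborel (\<lambda>t. t ^ k * unit_jacobi \<alpha> \<beta> n t)
    (if k < n then 0 else (- 1) ^ n * fact k / (fact n * fact (k - n)) * pochhammer (real n + \<alpha> + 1) (k - n)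
        * (Gamma (real n + \<alpha> + 1) * Gamma (real n + \<beta> + 1) / Gamma (real (k + n) + \<alpha> + \<beta> + 2)))"
proof -
  define c where "c s = ((real n + \<alpha>) gchoose (n - s)) * ((real n + \<beta>) gchoose s)" for s
  define G where "G = Gamma (real n + \<alpha> + 1) * Gamma (real n + \<beta> + 1) / Gamma (real (k + n) + \<alpha> + \<beta> + 2)"
  have "has_bochner_integral lborel (\<lambda>t. \<Sum>s\<le>n. (- 1) ^ s * c s *
      (indicator {0..1} t * (t powr (real (k + s) + \<alpha> + 1 - 1) * (1 - t) powr (real (n - s) + \<beta> + 1 - 1))))
     (\<Sum>s\<le>n. (- 1) ^ s * c s * Beta (real (k + s) + \<alpha> + 1) (real (n - s) + \<beta> + 1))"
    by (intro has_bochner_integral_sum has_bochner_integral_mult_right has_bochner_integral_Beta)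
      (use \<alpha> \<beta> in auto)
  also have "(\<lambda>t. \<Sum>s\<le>n. (- 1) ^ s * c s *
      (indicator {0..1} t * (t powr (real (k + s) + \<alpha> + 1 - 1) * (1 - t) powr (real (n - s) + \<beta> + 1 - 1)))) =
      (\<lambda>t. t ^ k * unit_jacobi \<alpha> \<beta> n t)"
  proof
    fix t :: real
    \<comment> \<open>At t = 0 and t = 1 both sides are 0 because \<open>0 powr a\<close> is 0 for
      every exponent, also for a = 0. Only in the open interval are the powers split.\<close>
    consider "t \<notin> {0..1}" | "t = 0" | "t = 1" | "0 < t" "t < 1" by fastforce
    then show "(\<Sum>s\<le>n. (- 1) ^ s * c s *
      (indicator {0..1} t * (t powr (real (k + s) + \<alpha> + 1 - 1) * (1 - t) powr (real (n - s) + \<beta> + 1 - 1)))) =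
        t ^ k * unit_jacobi \<alpha> \<beta> n t"
    proof cases
      case 4
      have *: "t powr (real (k + s) + \<alpha> + 1 - 1) = t ^ k * t ^ s * t powr \<alpha>"
           "(1 - t) powr (real (n - s) + \<beta> + 1 - 1) = (1 - t) ^ (n - s) * (1 - t) powr \<beta>" for s
        using 4 by (simp_all add: powr_add powr_realpow)
      then show ?thesis
        using 4 unfolding * unit_jacobi_def poly_jacobi_reflect
        by (simp add: c_def sum_distrib_left sum_distrib_right mult_ac)
    qed (auto simp: unit_jacobi_def)
  qed
  also have "(\<Sum>s\<le>n. (- 1) ^ s * c s * Beta (real (k + s) + \<alpha> + 1) (real (n - s) + \<beta> + 1)) =
     G / fact n * (\<Sum>s\<le>n. (- 1) ^ s * real (n choose s) * pochhammer (\<alpha> + 1 + real s) k)"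
    unfolding sum_distrib_left
  proof (intro sum.cong refl)
    fix s assume "s \<in> {..n}"
    then have s: "s \<le> n" by simp
    have *: "Gamma (x + real m) = pochhammer x m * Gamma x" if "x > 0" for x m
      using that by (subst pochhammer_Gamma) (auto elim!: nonpos_Ints_cases simp: less_imp_neq[OF Gamma_real_pos, symmetric])
    have 1: "Gamma (\<alpha> + real s + 1 + real (n - s)) = pochhammer (\<alpha> + real s + 1) (n - s) * Gamma (\<alpha> + real s + 1)"
            "Gamma (\<beta> + real (n - s) + 1 + real s) = pochhammer (\<beta> + real (n - s) + 1) s * Gamma (\<beta> + real (n - s) + 1)"
            "Gamma (\<alpha> + real s + 1 + real k) = pochhammer (\<alpha> + real s + 1) k * Gamma (\<alpha> + real s + 1)"
      by (rule *; use \<alpha> \<beta> in simp)+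
    have 2: "\<alpha> + real s + 1 + real (n - s) = real n + \<alpha> + 1" "\<beta> + real (n - s) + 1 + real s = real n + \<beta> + 1"
        "\<alpha> + real s + 1 + real k = real (k + s) + \<alpha> + 1" "real (n - s) + \<beta> + 1 = \<beta> + real (n - s) + 1"
       "real (k + s) + \<alpha> + 1 + (\<beta> + real (n - s) + 1) = real (k + n) + \<alpha> + \<beta> + 2" "\<alpha> + 1 + real s = \<alpha> + real s + 1"
      using s by (auto simp: of_nat_diff)
    have "c s * Beta (real (k + s) + \<alpha> + 1) (real (n - s) + \<beta> + 1) =
        G / fact n * (real (n choose s) * pochhammer (\<alpha> + 1 + real s) k)"
      unfolding c_def jacobi_coefficient[OF s] Beta_def G_def binomial_fact[OF s] 2 using 1[unfolded 2]
      by (simp add: mult_ac)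
    from arg_cong[OF this, of "\<lambda>x. (- 1) ^ s * x"]
    show "(- 1) ^ s * c s * Beta (real (k + s) + \<alpha> + 1) (real (n - s) + \<beta> + 1) =
         G / fact n * ((- 1) ^ s * real (n choose s) * pochhammer (\<alpha> + 1 + real s) k)"
      by (simp only: mult_ac)
  qed
  also have "\<dots> = (if k < n then 0 else (- 1) ^ n * fact k / (fact n * fact (k - n)) * pochhammer (real n + \<alpha> + 1) (k - n) * G)"
    by (subst alternating_binomial_sum_pochhammer) (simp add: add_ac mult_ac)
  finally show ?thesis unfolding G_def .
qed

text \<open>With k = n + i, the k! of the moment cancels the one of the exponential series, and
  Gamma(2n+i+\<alpha>+\<beta>+2) supplies the denominator (2n+\<alpha>+\<beta>+2)_i. The series thus
  starts at z^n, which is the origin of the factor (i\<omega>)^n in the transform.\<close>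

lemma unit_jacobi_kummer:
  assumes \<alpha>: "\<alpha> > -1" and \<beta>: "\<beta> > -1" and z: "z \<noteq> 0"
  shows "has_bochner_integral lborel (\<lambda>t. exp (z * of_real t) * of_real (unit_jacobi \<alpha> \<beta> n t))
    ((- z) ^ n * of_real (Beta (real n + \<alpha> + 1) (real n + \<beta> + 1) / fact n) *
      kummer_M (of_real (real n + \<alpha> + 1)) (of_real (2 * real n + \<alpha> + \<beta> + 2)) z)"
proof -
  let ?\<phi> = "\<lambda>t. complex_of_real (unit_jacobi \<alpha> \<beta> n t)"
  define a where "a = real n + \<alpha> + 1"
  define b where "b = real n + \<beta> + 1"
  have ab: "a > 0" "b > 0" using \<alpha> \<beta> by (auto simp: a_def b_def)
  have meas: "unit_jacobi \<alpha> \<beta> n \<in> borel_measurable borel"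
    unfolding unit_jacobi_def
    by (intro borel_measurable_times borel_measurable_indicator powr_real_measurable
        borel_measurable_continuous_onI[of "\<lambda>t. poly p (1 - 2 * t)" for p] continuous_intros) auto
  have meas\<phi>: "?\<phi> \<in> borel_measurable borel"
    using meas by simp
  have int: "integrable lborel ?\<phi>"
    using unit_jacobi_moment[OF \<alpha> \<beta>, of 0 n] by (simp add: has_bochner_integral_iff)
  have "integrable lborel (\<lambda>x. exp (of_real (norm z * \<bar>x\<bar>)) * ?\<phi> x)"
  proof (rule Bochner_Integration.integrable_bound)
    show "integrable lborel (\<lambda>x. of_real (exp (norm z)) * ?\<phi> x)"
      using int by simp
    show "AE x in lborel. norm (exp (of_real (norm z * \<bar>x\<bar>)) * ?\<phi> x) \<le> norm (of_real (exp (norm z)) * ?\<phi> x)"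
    proof (intro AE_I2)
      fix x :: real
      show "norm (exp (of_real (norm z * \<bar>x\<bar>)) * ?\<phi> x) \<le> norm (of_real (exp (norm z)) * ?\<phi> x)"
      proof (cases "x \<in> {0..1}")
        case True
        then have "norm z * \<bar>x\<bar> \<le> norm z" by (simp add: mult_left_le)
        then show ?thesis by (simp add: norm_mult mult_right_mono)
      qed (simp add: unit_jacobi_def)
    qed
  qed (use meas in simp)
  note ser = exp_series_integral[OF this meas\<phi>]
  define c where "c = (- 1) ^ n * Beta a b / fact n"
  have mom: "z ^ k / fact k * (LBINT x. of_real x ^ k * ?\<phi> x) = (if k < n then 0 else
      z ^ n * of_real c * (pochhammer (of_real a) (k - n) / pochhammer (of_real (a + b)) (k - n) * z ^ (k - n) / fact (k - n)))" for k
  proof -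
    have "(LBINT x. of_real x ^ k * ?\<phi> x) = of_real (LBINT x. x ^ k * unit_jacobi \<alpha> \<beta> n x)"
      unfolding integral_complex_of_real[symmetric] by simp
    also have "\<dots> = of_real (if k < n then 0 else (- 1) ^ n * fact k / (fact n * fact (k - n)) * pochhammer a (k - n)
        * (Gamma a * Gamma b / Gamma (real (k + n) + \<alpha> + \<beta> + 2)))"
      using has_bochner_integral_integral_eq[OF unit_jacobi_moment[OF \<alpha> \<beta>, of k n]] unfolding a_def b_def by simp
    also have "(if k < n then 0 else (- 1) ^ n * fact k / (fact n * fact (k - n)) * pochhammer a (k - n)
        * (Gamma a * Gamma b / Gamma (real (k + n) + \<alpha> + \<beta> + 2))) =
         (if k < n then 0 else fact k * c * (pochhammer a (k - n) / pochhammer (a + b) (k - n) / fact (k - n)))"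
    proof (cases "k < n")
      case False
      have "Gamma (a + b) > 0" using ab by (intro Gamma_real_pos) auto
      moreover have "a + b \<notin> \<int>\<^sub>\<le>\<^sub>0" using ab by (auto elim!: nonpos_Ints_cases)
      moreover have "real (k + n) + \<alpha> + \<beta> + 2 = a + b + real (k - n)"
        using False by (simp add: a_def b_def of_nat_diff)
      ultimately have "Gamma (real (k + n) + \<alpha> + \<beta> + 2) = pochhammer (a + b) (k - n) * Gamma (a + b)"
        by (simp add: pochhammer_Gamma)
      then show ?thesis
        using False by (simp add: c_def Beta_def mult_ac)
    qed simp
    finally show ?thesis
    proof (cases "k < n")
      case False
      then have "z ^ k = z ^ n * z ^ (k - n)" by (simp flip: power_add)
      moreover assume "(LBINT x. of_real x ^ k * ?\<phi> x) = of_real (if k < n then 0 else fact k * c * (pochhammer a (k - n) / pochhammer (a + b) (k - n) / fact (k - n)))"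
      ultimately show ?thesis
        using False by (simp add: pochhammer_of_real del: of_real_add)
    qed simp
  qed
  let ?I = "LBINT x. exp (z * of_real x) * ?\<phi> x"
  let ?t = "\<lambda>k. pochhammer (complex_of_real a) k / pochhammer (of_real (a + b)) k * z ^ k / fact k"
  have c0: "c \<noteq> 0"
  proof -
    have "Beta a b > 0" unfolding Beta_def using ab by (intro divide_pos_pos mult_pos_pos Gamma_real_pos) auto
    then show ?thesis by (simp add: c_def)
  qed
  have "(\<lambda>k. if k < n then 0 else z ^ n * of_real c * ?t (k - n)) sums ?I"
    using ser(2) unfolding mom .
  then have "(\<lambda>k. z ^ n * of_real c * ?t k) sums ?I"
    by (subst (asm) sums_zero_iff_shift[symmetric, of n]) auto
  \<comment> \<open>Dividing by the nonzero prefactor gives the convergence of the Kummer series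
    together with its value.\<close>
  then have "?t sums (?I / (z ^ n * of_real c))"
    using z c0 sums_divide[of "\<lambda>k. z ^ n * of_real c * ?t k" ?I "z ^ n * of_real c"] by simp
  then have "kummer_M (of_real a) (of_real (a + b)) z = ?I / (z ^ n * of_real c)"
    unfolding kummer_M_def by (rule sums_unique[symmetric])
  then have "?I = (- z) ^ n * of_real (Beta a b / fact n) * kummer_M (of_real a) (of_real (a + b)) z"
    using z c0 by (simp add: c_def power_minus[of z])
  moreover have "a + b = 2 * real n + \<alpha> + \<beta> + 2" by (simp add: a_def b_def)
  ultimately show ?thesis
    using ser(1) unfolding has_bochner_integral_iff a_def[symmetric] b_def[symmetric] by simp
qed

section \<open>Normalisation and transform on [-1,1]\<close>

definition jacobi_kernel :: "real \<Rightarrow> real \<Rightarrow> nat \<Rightarrow> real \<Rightarrow> real" where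
  "jacobi_kernel \<alpha> \<beta> n \<xi> = indicator {-1..1} \<xi> * (poly (jacobi_poly \<alpha> \<beta> n) \<xi> * jacobi_weight \<alpha> \<beta> \<xi>)"

text \<open>The argument is written \<open>1 + (- 2) * t\<close> to match the affine substitution
  rule for \<open>lborel\<close>.\<close>

lemma jacobi_kernel_reflect:
  "jacobi_kernel \<alpha> \<beta> n (1 + (- 2) * t) = 2 powr (\<alpha> + \<beta>) * unit_jacobi \<alpha> \<beta> n t"
proof (cases "t \<in> {0..1}")
  case True
  have "(2 * t) powr \<alpha> = 2 powr \<alpha> * t powr \<alpha>" "(2 * (1 - t)) powr \<beta> = 2 powr \<beta> * (1 - t) powr \<beta>"
    using True by (simp_all only: powr_mult)
  then have "jacobi_weight \<alpha> \<beta> (1 + (- 2) * t) = 2 powr (\<alpha> + \<beta>) * (t powr \<alpha> * (1 - t) powr \<beta>)"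
    by (simp add: jacobi_weight_def powr_add algebra_simps)
  then show ?thesis using True by (simp add: jacobi_kernel_def unit_jacobi_def mult_ac)
qed (auto simp: jacobi_kernel_def unit_jacobi_def)

lemma integrable_jacobi_kernel:
  assumes \<alpha>: "\<alpha> > -1" and \<beta>: "\<beta> > -1"
  shows "integrable lborel (jacobi_kernel \<alpha> \<beta> n)"
proof -
  have "integrable lborel (\<lambda>t. jacobi_kernel \<alpha> \<beta> n (1 + (- 2) * t))"
    unfolding jacobi_kernel_reflect using unit_jacobi_moment[OF \<alpha> \<beta>, of 0 n] by (simp add: has_bochner_integral_iff)
  then show ?thesis
    using lborel_integrable_real_affine_iff[of "- 2" "jacobi_kernel \<alpha> \<beta> n" 1] by simp
qed

lemma jacobi_norm_eq:
  assumes \<alpha>: "\<alpha> > -1" and \<beta>: "\<beta> > -1"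
  shows "jacobi_norm \<alpha> \<beta> n =
    2 * 2 powr (\<alpha> + \<beta>) * 2 ^ n * lead_coeff (jacobi_poly \<alpha> \<beta> n) * Beta (real n + \<alpha> + 1) (real n + \<beta> + 1)"
proof -
  let ?P = "jacobi_poly \<alpha> \<beta> n"
  let ?B = "Beta (real n + \<alpha> + 1) (real n + \<beta> + 1)"
  \<comment> \<open>By orthogonality only the top coefficient of the second factor of P in the square contributes.\<close>
  define R where "R = pcompose ?P [:1, - 2:]"
  have deg: "degree R = n" and lc: "coeff R n = lead_coeff ?P * (- 2) ^ n"
  proof -
    show "degree R = n" using degree_jacobi_poly[OF \<alpha> \<beta>, of n] by (simp add: R_def degree_pcompose)
    then show "coeff R n = lead_coeff ?P * (- 2) ^ n"
      using lead_coeff_comp[of "[:1, - 2:]" ?P] degree_jacobi_poly[OF \<alpha> \<beta>, of n] by (simp add: R_def)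
  qed
  have "has_bochner_integral lborel (\<lambda>t. \<Sum>k\<le>n. coeff R k * (t ^ k * unit_jacobi \<alpha> \<beta> n t))
      (\<Sum>k\<le>n. coeff R k * (if k < n then 0 else (- 1) ^ n * fact k / (fact n * fact (k - n)) * pochhammer (real n + \<alpha> + 1) (k - n)
        * (Gamma (real n + \<alpha> + 1) * Gamma (real n + \<beta> + 1) / Gamma (real (k + n) + \<alpha> + \<beta> + 2))))"
    by (intro has_bochner_integral_sum has_bochner_integral_mult_right unit_jacobi_moment \<alpha> \<beta>)
  also have "(\<lambda>t. \<Sum>k\<le>n. coeff R k * (t ^ k * unit_jacobi \<alpha> \<beta> n t)) = (\<lambda>t. poly ?P (1 + (- 2) * t) * unit_jacobi \<alpha> \<beta> n t)"
  proof
    fix t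
    have "poly ?P (1 + (- 2) * t) = poly R t" by (simp add: R_def poly_pcompose mult.commute)
    then show "(\<Sum>k\<le>n. coeff R k * (t ^ k * unit_jacobi \<alpha> \<beta> n t)) = poly ?P (1 + (- 2) * t) * unit_jacobi \<alpha> \<beta> n t"
      by (simp add: poly_altdef[of R] deg sum_distrib_left mult_ac)
  qed
  also have "(\<Sum>k\<le>n. coeff R k * (if k < n then 0 else (- 1) ^ n * fact k / (fact n * fact (k - n)) * pochhammer (real n + \<alpha> + 1) (k - n)
        * (Gamma (real n + \<alpha> + 1) * Gamma (real n + \<beta> + 1) / Gamma (real (k + n) + \<alpha> + \<beta> + 2)))) =
        (\<Sum>k\<in>{n}. coeff R k * ((- 1) ^ n * ?B))"
    by (rule sum.mono_neutral_cong_right) (auto simp: Beta_def add_ac)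
  also have "\<dots> = 2 ^ n * lead_coeff ?P * ?B"
    using power_mult_distrib[of "- 2 :: real" "- 1" n] by (simp add: lc)
  finally have "has_bochner_integral lborel (\<lambda>t. 2 powr (\<alpha> + \<beta>) * (poly ?P (1 + (- 2) * t) * unit_jacobi \<alpha> \<beta> n t))
      (2 powr (\<alpha> + \<beta>) * (2 ^ n * lead_coeff ?P * ?B))"
    by (rule has_bochner_integral_mult_right)
  also have "(\<lambda>t. 2 powr (\<alpha> + \<beta>) * (poly ?P (1 + (- 2) * t) * unit_jacobi \<alpha> \<beta> n t)) =
      (\<lambda>t. (\<lambda>\<xi>. poly ?P \<xi> * jacobi_kernel \<alpha> \<beta> n \<xi>) (1 + (- 2) * t))"
    unfolding jacobi_kernel_reflect by (simp add: mult_ac)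
  finally have "has_bochner_integral lborel (\<lambda>\<xi>. poly ?P \<xi> * jacobi_kernel \<alpha> \<beta> n \<xi>) (2 * (2 powr (\<alpha> + \<beta>) * (2 ^ n * lead_coeff ?P * ?B)))"
    by (subst lborel_has_bochner_integral_real_affine_iff[of "- 2" _ _ 1]) (simp_all add: field_simps)
  then have "(LBINT \<xi>. poly ?P \<xi> * jacobi_kernel \<alpha> \<beta> n \<xi>) = 2 * (2 powr (\<alpha> + \<beta>) * (2 ^ n * lead_coeff ?P * ?B))"
    by (rule has_bochner_integral_integral_eq)
  moreover have "jacobi_norm \<alpha> \<beta> n = (LBINT \<xi>. poly ?P \<xi> * jacobi_kernel \<alpha> \<beta> n \<xi>)"
    unfolding jacobi_norm_def set_lebesgue_integral_def
    by (rule Bochner_Integration.integral_cong) (auto simp: jacobi_kernel_def power2_eq_square)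
  ultimately show ?thesis by simp
qed

text \<open>Under \<xi> = 1 - 2t the phase e^(-iw\<delta>\<xi>) splits into e^(-iw\<delta>) and
  e^(zt) with z = 2iw\<delta>: this is the source of the exponential factor and of the argument of M
  in the transfer function.\<close>

lemma jacobi_kernel_multiplier:
  assumes \<alpha>: "\<alpha> > -1" and \<beta>: "\<beta> > -1" and \<delta>: "\<delta> > 0" and w: "w \<noteq> 0"
  shows "(- 1) ^ n * of_real (lead_coeff (jacobi_poly \<alpha> \<beta> n) * fact n / jacobi_norm \<alpha> \<beta> n * (1 / \<delta> ^ n)) *
      (LBINT \<xi>. exp (- \<i> * of_real (w * \<delta> * \<xi>)) * of_real (jacobi_kernel \<alpha> \<beta> n \<xi>)) =
     (\<i> * of_real w) ^ n * exp (- \<i> * of_real (w * \<delta>)) *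
     kummer_M (of_real (real n + \<alpha> + 1)) (of_real (2 * real n + \<alpha> + \<beta> + 2)) (2 * \<i> * of_real (w * \<delta>))"
proof -
  define z where "z = 2 * \<i> * of_real (w * \<delta>)"
  define B where "B = Beta (real n + \<alpha> + 1) (real n + \<beta> + 1)"
  define M where "M = kummer_M (of_real (real n + \<alpha> + 1)) (of_real (2 * real n + \<alpha> + \<beta> + 2)) z"
  define E where "E = exp (- \<i> * of_real (w * \<delta>))"
  define k where "k = lead_coeff (jacobi_poly \<alpha> \<beta> n)"
  have k: "k > 0" unfolding k_def by (rule lead_coeff_jacobi_poly_pos[OF \<alpha> \<beta>])
  have B: "B > 0" unfolding B_def Beta_def using \<alpha> \<beta> by (intro divide_pos_pos mult_pos_pos Gamma_real_pos) auto
  have z: "z \<noteq> 0" using \<delta> w by (simp add: z_def)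
  have "(LBINT \<xi>. exp (- \<i> * of_real (w * \<delta> * \<xi>)) * of_real (jacobi_kernel \<alpha> \<beta> n \<xi>)) =
     2 * (LBINT t. exp (- \<i> * of_real (w * \<delta> * (1 + (- 2) * t))) * of_real (jacobi_kernel \<alpha> \<beta> n (1 + (- 2) * t)))"
    by (subst lborel_integral_real_affine[of "- 2" _ 1]) (simp_all add: scaleR_conv_of_real)
  also have "(\<lambda>t. exp (- \<i> * of_real (w * \<delta> * (1 + (- 2) * t))) * of_real (jacobi_kernel \<alpha> \<beta> n (1 + (- 2) * t))) =
     (\<lambda>t. E * of_real (2 powr (\<alpha> + \<beta>)) * (exp (z * of_real t) * of_real (unit_jacobi \<alpha> \<beta> n t)))"
    unfolding jacobi_kernel_reflect
    by (simp add: fun_eq_iff E_def z_def algebra_simps flip: exp_add)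
  also have "(LBINT t. E * of_real (2 powr (\<alpha> + \<beta>)) * (exp (z * of_real t) * of_real (unit_jacobi \<alpha> \<beta> n t))) =
     E * of_real (2 powr (\<alpha> + \<beta>)) * ((- z) ^ n * of_real (B / fact n) * M)"
    using has_bochner_integral_integral_eq[OF unit_jacobi_kummer[OF \<alpha> \<beta> z, of n]] by (simp add: B_def M_def)
  finally have I: "(LBINT \<xi>. exp (- \<i> * of_real (w * \<delta> * \<xi>)) * of_real (jacobi_kernel \<alpha> \<beta> n \<xi>)) =
    2 * (E * of_real (2 powr (\<alpha> + \<beta>)) * ((- z) ^ n * of_real (B / fact n) * M))" .
  have "z = 2 * of_real \<delta> * (\<i> * of_real w)" by (simp add: z_def)
  then have "z ^ n = 2 ^ n * of_real (\<delta> ^ n) * (\<i> * of_real w) ^ n"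
    by (simp add: power_mult_distrib)
  moreover have "(- 1) ^ n * (- z) ^ n = z ^ n"
    by (subst power_mult_distrib[symmetric]) simp
  ultimately have zn: "(- 1) ^ n * (- z) ^ n = 2 ^ n * of_real (\<delta> ^ n) * (\<i> * of_real w) ^ n" by simp
  \<comment> \<open>The leading coefficient, the Beta function and the powers of 2 from the weight
    cancel against the norm. What is left, 1/(2\<delta>)^n, reduces z^n = (2iw\<delta>)^n to
    (iw)^n.\<close>
  have c: "k * fact n / jacobi_norm \<alpha> \<beta> n * (1 / \<delta> ^ n) * 2 * 2 powr (\<alpha> + \<beta>) * (B / fact n) = 1 / (2 ^ n * \<delta> ^ n)"
    unfolding jacobi_norm_eq[OF \<alpha> \<beta>] k_def[symmetric] B_def[symmetric] using k B \<delta> by simp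
  have "(- 1) ^ n * of_real (k * fact n / jacobi_norm \<alpha> \<beta> n * (1 / \<delta> ^ n)) *
     (2 * (E * of_real (2 powr (\<alpha> + \<beta>)) * ((- z) ^ n * of_real (B / fact n) * M))) =
     ((- 1) ^ n * (- z) ^ n) * E * M * of_real (k * fact n / jacobi_norm \<alpha> \<beta> n * (1 / \<delta> ^ n) * 2 * 2 powr (\<alpha> + \<beta>) * (B / fact n))"
    by simp
  also have "\<dots> = (\<i> * of_real w) ^ n * E * M"
    unfolding zn c using \<delta> by simp
  finally show ?thesis
    unfolding I k_def[symmetric] z_def[symmetric] M_def[symmetric] E_def[symmetric] .
qed

section \<open>Integrability and Fubini\<close>

lemma integrable_powr_tail:
  assumes "e < (-1::real)"
  shows "integrable lborel (\<lambda>x. indicator {1..} x * x powr e)"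
proof -
  have "(\<lambda>x. x powr e) integrable_on {1..}"
    using has_integral_powr_to_inf[of e 1] assms by (auto intro: has_integral_integrable)
  then have "set_integrable lebesgue {1..} (\<lambda>x. x powr e)"
    by (intro nonnegative_absolutely_integrable_1) auto
  then show ?thesis
    unfolding set_integrable_def real_scaleR_def by (subst (asm) integrable_completion) auto
qed

lemma integrable_inverse_square: "integrable lborel (\<lambda>x::real. 1 / (1 + \<bar>x\<bar>)\<^sup>2)"
proof -
  let ?h = "\<lambda>x::real. indicator {1..} x * x powr - 2"
  have h: "integrable lborel ?h" by (rule integrable_powr_tail) simp
  have "integrable lborel (\<lambda>x. ?h (1 + 1 * x) + ?h (1 + (- 1) * x))"
    by (intro Bochner_Integration.integrable_add lborel_integrable_real_affine h) auto
  then show ?thesis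
  proof (rule Bochner_Integration.integrable_bound)
    show "AE x in lborel. norm (1 / (1 + \<bar>x\<bar>)\<^sup>2) \<le> norm (?h (1 + 1 * x) + ?h (1 + (- 1) * x))"
    proof (rule AE_I2)
      fix x :: real
      have pw: "y powr - 2 = 1 / y\<^sup>2" if "y \<ge> 1" for y :: real
        using that by (simp add: powr_minus divide_inverse)
      show "norm (1 / (1 + \<bar>x\<bar>)\<^sup>2) \<le> norm (?h (1 + 1 * x) + ?h (1 + (- 1) * x))"
      proof (cases "x \<ge> 0")
        case True
        then have "norm (1 / (1 + \<bar>x\<bar>)\<^sup>2) \<le> ?h (1 + 1 * x)" by (simp add: pw)
        also have "\<dots> \<le> norm (?h (1 + 1 * x) + ?h (1 + (- 1) * x))"
          unfolding real_norm_def by (rule order_trans[OF _ abs_ge_self]) simp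
        finally show ?thesis .
      next
        case False
        then have "norm (1 / (1 + \<bar>x\<bar>)\<^sup>2) \<le> ?h (1 + (- 1) * x)" by (simp add: pw)
        also have "\<dots> \<le> norm (?h (1 + 1 * x) + ?h (1 + (- 1) * x))"
          unfolding real_norm_def by (rule order_trans[OF _ abs_ge_self]) simp
        finally show ?thesis .
      qed
    qed
  qed simp
qed

text \<open>Separates a shift from the point that is shifted. Only the positive part of the point is
  charged, because a decay of f is available only to the right.\<close>

lemma one_plus_max_mult: "1 + max (x + y) 0 \<le> (1 + max x 0) * (1 + \<bar>y::real\<bar>)"
proof -
  have "(1 + max x 0) * (1 + \<bar>y\<bar>) = 1 + max x 0 + \<bar>y\<bar> + max x 0 * \<bar>y\<bar>" by (simp add: algebra_simps)
  moreover have "max x 0 * \<bar>y\<bar> \<ge> 0" by simp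
  ultimately show ?thesis by linarith
qed

text \<open>The bound is sharp enough for tails of order \<open>- Re l - \<epsilon>\<close>: it costs nothing if \<open>Re l \<le> 1\<close>,
  and only the power \<open>Re l - 1\<close> otherwise.\<close>

lemma weyl_kernel_damped_bound:
  fixes m :: "real \<Rightarrow> complex"
  assumes l: "Re l > 0" and b: "b = max (Re l - 1) 0"
    and [measurable]: "m \<in> borel_measurable borel"
    and m: "\<And>x. norm (m x) \<le> C * (1 + \<bar>x\<bar>) powr (- (b + 2))"
  obtains D where "D \<ge> 0"
    "\<And>z. integrable lborel (\<lambda>s. weyl_kernel l s * m (z - s))"
    "\<And>z. (LBINT s. norm (weyl_kernel l s * m (z - s))) \<le> D * (1 + max z 0) powr b"
proof -
  define a where "a = Re l"
  have a: "a > 0" using l by (simp add: a_def)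
  have C: "C \<ge> 0" using m[of 0] by (simp add: order_trans[OF norm_ge_zero])
  \<comment> \<open>\<open>?near\<close> takes the singularity of the kernel at 0 and has the form
    of the integrand of Beta(a, 1). \<open>?far\<close> takes the rest: of the decay b + 2 of
    \<open>m\<close>, the part b compensates the growth of the kernel, and the integrable power -2
    remains.\<close>
  let ?near = "\<lambda>s. indicator {0..1} s * (s powr (a - 1) * (1 - s) powr (1 - 1))"
  let ?far = "\<lambda>x. 1 / (1 + \<bar>x::real\<bar>)\<^sup>2"
  define K where "K = C / norm (Gamma l)"
  have K: "K \<ge> 0" using C by (simp add: K_def)
  have near: "integrable lborel ?near"
    using has_bochner_integral_Beta[of a 1] a by (simp add: has_bochner_integral_iff)
  have far_z: "integrable lborel (\<lambda>s. ?far (z - s))" and far_int: "(LBINT s. ?far (z - s)) = (LBINT x. ?far x)" for z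
    using lborel_integrable_real_affine[OF integrable_inverse_square, of "- 1" z]
      lborel_integral_real_affine[of "- 1" ?far z] by simp_all
  have bnd: "norm (weyl_kernel l s * m (z - s)) \<le> (1 + max z 0) powr b * (K * (?near s + ?far (z - s)))" for z s
  proof (cases "s > 0")
    case True
    have b0: "b \<ge> 0" using b by simp
    have "s powr (a - 1) * norm (m (z - s)) \<le> (1 + max z 0) powr b * (C * (?near s + ?far (z - s)))"
    proof (cases "s < 1")
      case lt1: True
      have "norm (m (z - s)) \<le> C * 1"
      proof (rule order_trans[OF m mult_left_mono[OF _ C]])
        show "(1 + \<bar>z - s\<bar>) powr - (b + 2) \<le> 1"
          using powr_mono[of "- (b + 2)" 0 "1 + \<bar>z - s\<bar>"] b0 by (simp split: if_splits)
      qed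
      then have "s powr (a - 1) * norm (m (z - s)) \<le> s powr (a - 1) * C"
        by (intro mult_left_mono) auto
      also have "\<dots> = 1 * (C * ?near s)" using True lt1 by simp
      also have "\<dots> \<le> (1 + max z 0) powr b * (C * (?near s + ?far (z - s)))"
        using C b0 by (intro mult_mono) (auto intro!: ge_one_powr_ge_zero)
      finally show ?thesis .
    next
      case False
      have pos: "(1 + \<bar>z - s\<bar>) > 0" by linarith
      have "s powr (a - 1) \<le> s powr b" using False b by (intro powr_mono) (auto simp: a_def)
      also have "\<dots> \<le> ((1 + max z 0) * (1 + \<bar>s - z\<bar>)) powr b"
        using one_plus_max_mult[of z "s - z"] True b0 by (intro powr_mono2) auto
      also have "\<dots> = (1 + max z 0) powr b * (1 + \<bar>z - s\<bar>) powr b"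
        by (simp add: powr_mult abs_minus_commute)
      finally have "s powr (a - 1) * norm (m (z - s)) \<le>
          ((1 + max z 0) powr b * (1 + \<bar>z - s\<bar>) powr b) * (C * (1 + \<bar>z - s\<bar>) powr (- (b + 2)))"
        using m by (intro mult_mono) auto
      also have "\<dots> = (1 + max z 0) powr b * (C * ((1 + \<bar>z - s\<bar>) powr b * (1 + \<bar>z - s\<bar>) powr (- (b + 2))))"
        by (simp add: mult_ac)
      also have "(1 + \<bar>z - s\<bar>) powr b * (1 + \<bar>z - s\<bar>) powr (- (b + 2)) = ?far (z - s)"
        using pos by (simp add: powr_minus_divide flip: powr_add)
      also have "(1 + max z 0) powr b * (C * ?far (z - s)) \<le> (1 + max z 0) powr b * (C * (?near s + ?far (z - s)))"
        using C by (intro mult_left_mono) auto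
      finally show ?thesis .
    qed
    then show ?thesis
      using True by (simp add: norm_mult norm_weyl_kernel K_def a_def divide_right_mono)
  qed (use K in \<open>auto simp: weyl_kernel_def\<close>)
  have int_bnd: "integrable lborel (\<lambda>s. (1 + max z 0) powr b * (K * (?near s + ?far (z - s))))" for z
    by (intro Bochner_Integration.integrable_add integrable_mult_right near far_z)
  have int: "integrable lborel (\<lambda>s. weyl_kernel l s * m (z - s))" for z
  proof (rule Bochner_Integration.integrable_bound[OF int_bnd])
    show "AE s in lborel. norm (weyl_kernel l s * m (z - s)) \<le> norm ((1 + max z 0) powr b * (K * (?near s + ?far (z - s))))"
      unfolding real_norm_def by (rule AE_I2, rule order_trans[OF bnd abs_ge_self])
  qed measurable
  show thesis
  proof (rule that[of "K * ((LBINT s. ?near s) + (LBINT x. ?far x))"])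
    show "0 \<le> K * ((LBINT s. ?near s) + (LBINT x. ?far x))"
      using K by (intro mult_nonneg_nonneg add_nonneg_nonneg integral_nonneg_AE) auto
    fix z
    show "integrable lborel (\<lambda>s. weyl_kernel l s * m (z - s))" by (rule int)
    have "(LBINT s. norm (weyl_kernel l s * m (z - s))) \<le> (LBINT s. (1 + max z 0) powr b * (K * (?near s + ?far (z - s))))"
      by (intro integral_mono integrable_norm int int_bnd bnd)
    also have "\<dots> = (1 + max z 0) powr b * (K * ((LBINT s. ?near s) + (LBINT x. ?far x)))"
      using near far_z[of z] by (simp only: integral_mult_right_zero Bochner_Integration.integral_add far_int)
    also have "\<dots> = K * ((LBINT s. ?near s) + (LBINT x. ?far x)) * (1 + max z 0) powr b"
      by (rule mult.commute)
    finally show "(LBINT s. norm (weyl_kernel l s * m (z - s))) \<le> K * ((LBINT s. ?near s) + (LBINT x. ?far x)) * (1 + max z 0) powr b" .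
  qed
qed

text \<open>For a \<le> 1 the weight is constant 1. For a > 1 the tail bound times the weight has
  exponent -a - \<epsilon> + (a - 1) = -1 - \<epsilon>, and up to the point \<open>Y\<close> where
  the tail bound sets in the weight is bounded, so that the integrability of \<open>f\<close> is
  enough there.\<close>

lemma integrable_weighted_tail:
  fixes f :: "real \<Rightarrow> complex"
  assumes f: "integrable lborel f" and \<epsilon>: "\<epsilon> > 0" and b: "b = max (a - 1) 0"
    and tail: "f \<in> O[at_top](\<lambda>x. complex_of_real (x powr (- a - \<epsilon>)))"
  shows "integrable lborel (\<lambda>y. norm (f y) * (1 + max y 0) powr b)"
proof (cases "a \<le> 1")
  case True
  then have "b = 0" using b by simp
  moreover have "(1 + max y 0) powr 0 = 1" for y :: real by (simp add: max_def)
  ultimately show ?thesis using integrable_norm[OF f] by simp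
next
  case False
  then have b: "b = a - 1" "b > 0" using b by auto
  obtain c where c: "c > 0" and ev: "eventually (\<lambda>x. norm (f x) \<le> c * norm (complex_of_real (x powr (- a - \<epsilon>)))) at_top"
    using landau_o.bigE[OF tail] by blast
  then obtain Y0 where Y0: "\<And>x. x \<ge> Y0 \<Longrightarrow> norm (f x) \<le> c * x powr (- a - \<epsilon>)"
    unfolding eventually_at_top_linorder by auto
  define Y where "Y = max 1 Y0"
  let ?w = "\<lambda>y. (1 + Y) powr b * norm (f y) + c * 2 powr b * (indicator {1..} y * y powr (- 1 - \<epsilon>))"
  have "integrable lborel ?w"
    using \<epsilon> by (intro Bochner_Integration.integrable_add integrable_mult_right integrable_norm f integrable_powr_tail) auto
  then show ?thesis
  proof (rule Bochner_Integration.integrable_bound)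
    show "AE y in lborel. norm (norm (f y) * (1 + max y 0) powr b) \<le> norm (?w y)"
    proof (rule AE_I2)
      fix y :: real
      have "norm (f y) * (1 + max y 0) powr b \<le> ?w y"
      proof (cases "y \<le> Y")
        case True
        then have "(1 + max y 0) powr b \<le> (1 + Y) powr b"
          using b by (intro powr_mono2) (auto simp: Y_def)
        then have "norm (f y) * (1 + max y 0) powr b \<le> norm (f y) * (1 + Y) powr b"
          by (rule mult_left_mono) simp
        also have "\<dots> \<le> ?w y" using c by (simp add: mult.commute)
        finally show ?thesis .
      next
        case False
        then have y: "y \<ge> 1" "y \<ge> Y0" by (auto simp: Y_def)
        have "norm (f y) * (1 + max y 0) powr b \<le> (c * y powr (- a - \<epsilon>)) * (2 * y) powr b"
          using y b c Y0 by (intro mult_mono powr_mono2) auto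
        also have "\<dots> = c * 2 powr b * (y powr (- a - \<epsilon>) * y powr b)"
          using y by (simp add: powr_mult)
        also have "y powr (- a - \<epsilon>) * y powr b = indicator {1..} y * y powr (- 1 - \<epsilon>)"
        proof -
          have "y powr (- a - \<epsilon>) * y powr b = y powr (- a - \<epsilon> + b)" by (simp add: powr_add)
          also have "- a - \<epsilon> + b = - 1 - \<epsilon>" using b by simp
          finally show ?thesis using y by simp
        qed
        also have "c * 2 powr b * \<dots> \<le> ?w y" by simp
        finally show ?thesis .
      qed
      then show "norm (norm (f y) * (1 + max y 0) powr b) \<le> norm (?w y)" by simp
    qed
  qed (use f in measurable)
qed

lemma integrable_tensor:
  fixes g h :: "real \<Rightarrow> 'a :: {real_normed_field, banach, second_countable_topology}"
  assumes g: "integrable lborel g" and h: "integrable lborel h"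
  shows "integrable (lborel \<Otimes>\<^sub>M lborel) (\<lambda>(x, y). g x * h y)"
proof (rule lborel_pair.Fubini_integrable)
  note [measurable] = borel_measurable_integrable[OF g] borel_measurable_integrable[OF h]
  show "(\<lambda>(x, y). g x * h y) \<in> borel_measurable (lborel \<Otimes>\<^sub>M lborel)" by measurable
  show "integrable lborel (\<lambda>x. LBINT y. norm (case (x, y) of (x, y) \<Rightarrow> g x * h y))"
    using g by (simp add: norm_mult)
  show "AE x in lborel. integrable lborel (\<lambda>y. case (x, y) of (x, y) \<Rightarrow> g x * h y)"
    using h by simp
qed

lemma Fubini_bounded_kernel:
  fixes g h :: "real \<Rightarrow> complex" and K :: "real \<Rightarrow> real \<Rightarrow> complex"
  assumes g: "integrable lborel g" and h: "integrable lborel h"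
    and [measurable]: "case_prod K \<in> borel_measurable (borel \<Otimes>\<^sub>M borel)"
    and K: "\<And>x y. norm (K x y) \<le> B"
  shows "(LBINT x. g x * (LBINT y. h y * K x y)) = (LBINT y. h y * (LBINT x. g x * K x y))"
proof -
  note [measurable] = borel_measurable_integrable[OF g] borel_measurable_integrable[OF h]
  have "integrable (lborel \<Otimes>\<^sub>M lborel) (\<lambda>(x, y). g x * h y * K x y)"
  proof (rule Bochner_Integration.integrable_bound)
    show "integrable (lborel \<Otimes>\<^sub>M lborel) (\<lambda>p. of_real B * (case p of (x, y) \<Rightarrow> g x * h y))"
      by (intro integrable_mult_right integrable_tensor g h)
    show "AE p in lborel \<Otimes>\<^sub>M lborel. norm (case p of (x, y) \<Rightarrow> g x * h y * K x y) \<le> norm (of_real B * (case p of (x, y) \<Rightarrow> g x * h y))"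
    proof (rule AE_I2, clarify)
      fix x y
      have "norm (g x * h y) * norm (K x y) \<le> norm (g x * h y) * \<bar>B\<bar>"
        using order_trans[OF K abs_ge_self] by (intro mult_left_mono) auto
      then show "norm (g x * h y * K x y) \<le> norm (of_real B * (g x * h y))"
        by (simp add: norm_mult mult_ac)
    qed
  qed measurable
  from lborel_pair.Fubini_integral[OF this]
  have "(LBINT y. LBINT x. g x * h y * K x y) = (LBINT x. LBINT y. g x * h y * K x y)" by simp
  moreover have "(LBINT x. g x * h y * K x y) = h y * (LBINT x. g x * K x y)" for y
    by (subst integral_mult_right_zero[symmetric]) (simp add: mult_ac)
  moreover have "(LBINT y. g x * h y * K x y) = g x * (LBINT y. h y * K x y)" for x
    by (subst integral_mult_right_zero[symmetric]) (simp add: mult_ac)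
  ultimately show ?thesis by simp
qed

text \<open>Absolute convergence of the triple integral is checked with x innermost.
  \<open>S\<close> bounds that integral in terms of the shifted point y - \<delta>\<xi>, and
  \<open>ST\<close> trades it for a bound \<open>T\<close> free of \<xi>, which leaves a tensor
  product. The factor \<open>norm (Q \<xi>)\<close> on both sides of \<open>ST\<close> restricts
  this comparison to the support of \<open>Q\<close>.\<close>

lemma Fubini_convolution:
  fixes \<phi> Q f k :: "real \<Rightarrow> complex" and S T :: "real \<Rightarrow> real" and \<delta> :: real
  assumes [measurable]: "\<phi> \<in> borel_measurable borel" "k \<in> borel_measurable borel"
    and Q: "integrable lborel Q" and f: "integrable lborel f"
    and k\<phi>: "\<And>z. integrable lborel (\<lambda>s. k s * \<phi> (z - s))"
    and S: "\<And>z. (LBINT s. norm (k s * \<phi> (z - s))) \<le> S z"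
    and ST: "\<And>\<xi> y. norm (Q \<xi>) * S (y - \<delta> * \<xi>) \<le> norm (Q \<xi>) * T y"
    and fT: "integrable lborel (\<lambda>y. norm (f y) * T y)"
  shows "(LBINT x. \<phi> x * (LBINT \<xi>. Q \<xi> * (LBINT y. f y * k (y - (x + \<delta> * \<xi>))))) =
    (LBINT \<xi>. Q \<xi> * (LBINT y. f y * (LBINT s. k s * \<phi> (y - \<delta> * \<xi> - s))))"
proof -
  note [measurable] = borel_measurable_integrable[OF Q] borel_measurable_integrable[OF f]
  interpret P: pair_sigma_finite "lborel \<Otimes>\<^sub>M lborel :: (real \<times> real) measure" "lborel :: real measure"
    unfolding lborel_prod ..
  define u where "u p x = (case p of (\<xi>, y) \<Rightarrow> Q \<xi> * f y * (k (y - (x + \<delta> * \<xi>)) * \<phi> x))" for p x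
  have [measurable]: "case_prod u \<in> borel_measurable ((lborel \<Otimes>\<^sub>M lborel) \<Otimes>\<^sub>M lborel)"
    unfolding u_def by measurable
  have refl_int: "integrable lborel (\<lambda>x. k (z - x) * \<phi> x)"
    and refl_eq: "(LBINT x. k (z - x) * \<phi> x) = (LBINT s. k s * \<phi> (z - s))"
    and refl_norm: "(LBINT x. norm (k (z - x) * \<phi> x)) = (LBINT s. norm (k s * \<phi> (z - s)))" for z
    using lborel_integrable_real_affine[OF k\<phi>, of "- 1" z z]
      lborel_integral_real_affine[of "- 1" "\<lambda>s. k s * \<phi> (z - s)" z]
      lborel_integral_real_affine[of "- 1" "\<lambda>s. norm (k s * \<phi> (z - s))" z] by simp_all
  have shift: "y - (x + \<delta> * \<xi>) = (y - \<delta> * \<xi>) - x" for x y \<xi> by simp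
  have u_int: "integrable lborel (\<lambda>x. u (\<xi>, y) x)" for \<xi> y
    unfolding u_def prod.case shift by (intro integrable_mult_right refl_int)
  have u_fst: "(LBINT x. u (\<xi>, y) x) = Q \<xi> * f y * (LBINT s. k s * \<phi> (y - \<delta> * \<xi> - s))" for \<xi> y
    unfolding u_def prod.case shift integral_mult_right_zero refl_eq ..
  have u_norm: "(LBINT x. norm (u (\<xi>, y) x)) \<le> norm (Q \<xi>) * (norm (f y) * T y)" for \<xi> y
  proof -
    have "(LBINT x. norm (u (\<xi>, y) x)) = norm (f y) * (norm (Q \<xi>) * (LBINT s. norm (k s * \<phi> (y - \<delta> * \<xi> - s))))"
      unfolding refl_norm[symmetric] u_def prod.case shift norm_mult[of "Q \<xi> * f y"] integral_mult_right_zero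
      by (simp add: norm_mult mult_ac)
    also have "\<dots> \<le> norm (f y) * (norm (Q \<xi>) * T y)"
      by (intro mult_left_mono order_trans[OF mult_left_mono[OF S] ST]) auto
    finally show ?thesis by (simp add: mult_ac)
  qed
  have int: "integrable ((lborel \<Otimes>\<^sub>M lborel) \<Otimes>\<^sub>M lborel) (case_prod u)"
  proof (rule P.Fubini_integrable)
    show "integrable (lborel \<Otimes>\<^sub>M lborel) (\<lambda>p. LBINT x. norm (case (p, x) of (p, x) \<Rightarrow> u p x))"
    proof (rule Bochner_Integration.integrable_bound)
      show "integrable (lborel \<Otimes>\<^sub>M lborel) (\<lambda>(\<xi>, y). norm (Q \<xi>) * (norm (f y) * T y))"
        by (intro integrable_tensor integrable_norm Q fT)
      show "AE p in lborel \<Otimes>\<^sub>M lborel. norm (LBINT x. norm (case (p, x) of (p, x) \<Rightarrow> u p x)) \<le>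
          norm (case p of (\<xi>, y) \<Rightarrow> norm (Q \<xi>) * (norm (f y) * T y))"
      proof (rule AE_I2, clarify)
        fix \<xi> y
        have "0 \<le> (LBINT x. norm (u (\<xi>, y) x))" by (intro integral_nonneg_AE) auto
        with u_norm[of \<xi> y] show "norm (LBINT x. norm (u (\<xi>, y) x)) \<le> norm (norm (Q \<xi>) * (norm (f y) * T y))"
          unfolding real_norm_def by linarith
      qed
    qed measurable
    show "AE p in lborel \<Otimes>\<^sub>M lborel. integrable lborel (\<lambda>x. case (p, x) of (p, x) \<Rightarrow> u p x)"
      by (rule AE_I2, clarify) (simp add: u_int)
  qed measurable
  have "(LBINT x. \<phi> x * (LBINT \<xi>. Q \<xi> * (LBINT y. f y * k (y - (x + \<delta> * \<xi>))))) =
      (LBINT x. (\<integral>p. u p x \<partial>(lborel \<Otimes>\<^sub>M lborel)))"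
  proof (rule integral_cong_AE)
    \<comment> \<open>Joint integrability makes the section at x integrable only for almost every x,
      so the inner Fubini theorem gives an equality almost everywhere.\<close>
    show "AE x in lborel. \<phi> x * (LBINT \<xi>. Q \<xi> * (LBINT y. f y * k (y - (x + \<delta> * \<xi>)))) =
        (\<integral>p. u p x \<partial>(lborel \<Otimes>\<^sub>M lborel))"
      using P.AE_integrable_snd[OF int]
    proof eventually_elim
      fix x assume "integrable (lborel \<Otimes>\<^sub>M lborel) (\<lambda>p. u p x)"
      from lborel_pair.integral_fst'[OF this]
      have "(\<integral>p. u p x \<partial>(lborel \<Otimes>\<^sub>M lborel)) = (LBINT \<xi>. LBINT y. u (\<xi>, y) x)" by simp
      also have "\<dots> = (LBINT \<xi>. \<phi> x * (Q \<xi> * (LBINT y. f y * k (y - (x + \<delta> * \<xi>)))))"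
        by (simp only: u_def prod.case mult_ac flip: integral_mult_right_zero)
      finally show "\<phi> x * (LBINT \<xi>. Q \<xi> * (LBINT y. f y * k (y - (x + \<delta> * \<xi>)))) =
        (\<integral>p. u p x \<partial>(lborel \<Otimes>\<^sub>M lborel))" by simp
    qed
  qed measurable
  also have "\<dots> = (\<integral>p. (LBINT x. u p x) \<partial>(lborel \<Otimes>\<^sub>M lborel))"
    using P.Fubini_integral[OF int] .
  also have "\<dots> = (LBINT \<xi>. LBINT y. LBINT x. u (\<xi>, y) x)"
    using lborel_pair.integral_fst'[OF P.integrable_fst[OF int]] by simp
  also have "\<dots> = (LBINT \<xi>. Q \<xi> * (LBINT y. f y * (LBINT s. k s * \<phi> (y - \<delta> * \<xi> - s))))"
    unfolding u_fst mult.assoc by simp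
  finally show ?thesis .
qed

section \<open>The Gamma density and the damping factor\<close>

text \<open>The density t^(N-1) e^(-t) / (N-1)! on t > 0 for N > 0. Expressed through the Weyl
  kernel of order N, its characteristic function \<open>damping N\<close> is the Laplace transform
  of that kernel at 1 - ix.\<close>

definition gamma_density :: "nat \<Rightarrow> real \<Rightarrow> complex" where
  "gamma_density N t = weyl_kernel (of_nat N) t * exp (- of_real t)"

definition damping :: "nat \<Rightarrow> real \<Rightarrow> complex" where
  "damping N x = (1 - \<i> * of_real x) powr - of_nat N"

lemma gamma_density_measurable [measurable]: "gamma_density N \<in> borel_measurable borel"
  unfolding gamma_density_def by measurable

lemma damping_fourier:
  assumes "N > 0"
  shows "has_bochner_integral lborel (\<lambda>t. gamma_density N t * exp (\<i> * of_real (t * x))) (damping N x)"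
proof -
  have "gamma_density N t * exp (\<i> * of_real (t * x)) =
    weyl_kernel (of_nat N) t * exp (- ((1 - \<i> * of_real x) * of_real t))" for t
    by (simp add: gamma_density_def algebra_simps flip: exp_add)
  then show ?thesis
    using weyl_kernel_Laplace[of "of_nat N" "1 - \<i> * of_real x"] assms by (simp add: damping_def)
qed

lemma damping_0 [simp]: "damping N 0 = 1"
  by (simp add: damping_def)

lemma integrable_gamma_density: "N > 0 \<Longrightarrow> integrable lborel (gamma_density N)"
  and integral_gamma_density: "N > 0 \<Longrightarrow> (LBINT t. gamma_density N t) = 1"
  using damping_fourier[of N 0] by (simp_all add: has_bochner_integral_iff)

lemma continuous_on_damping: "continuous_on UNIV (damping N)"
  unfolding damping_def by (intro continuous_intros) (auto simp: complex_nonpos_Reals_iff)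

lemma damping_measurable [measurable]: "damping N \<in> borel_measurable borel"
  by (rule borel_measurable_continuous_onI[OF continuous_on_damping])

lemma norm_one_minus_ii: "1 \<le> norm (1 - \<i> * complex_of_real x)" "\<bar>x\<bar> \<le> norm (1 - \<i> * complex_of_real x)"
  using abs_Re_le_cmod[of "1 - \<i> * complex_of_real x"] abs_Im_le_cmod[of "1 - \<i> * complex_of_real x"] by simp_all

lemma norm_damping: "norm (damping N x) = norm (1 - \<i> * complex_of_real x) powr - real N"
proof -
  have nz: "1 - \<i> * complex_of_real x \<noteq> 0" using norm_one_minus_ii(1)[of x] by auto
  have "damping N x = inverse ((1 - \<i> * complex_of_real x) ^ N)"
    using nz by (simp add: damping_def powr_minus powr_nat')
  then show ?thesis using nz by (simp add: norm_inverse norm_power powr_minus powr_realpow)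
qed

lemma norm_damping_le_1: "norm (damping N x) \<le> 1"
  unfolding norm_damping using norm_one_minus_ii(1)[of x]
  using powr_mono[of "- real N" 0 "norm (1 - \<i> * complex_of_real x)"] by (simp split: if_splits)

text \<open>The constant blows up as \<open>c\<close> \<rightarrow> 0. It only secures absolute
  convergence at a fixed scale; the limit of vanishing damping relies on
  \<open>norm_damping_le_1\<close>.\<close>

lemma norm_damping_decay:
  assumes c: "c \<noteq> 0" and q: "0 \<le> q" "q \<le> real N"
  shows "norm (damping N (c * x)) \<le> (1 + 1 / \<bar>c\<bar>) powr q * (1 + \<bar>x\<bar>) powr - q"
proof -
  let ?r = "norm (1 - \<i> * complex_of_real (c * x))"
  have r: "?r \<ge> 1" and r': "\<bar>c * x\<bar> \<le> ?r" by (fact norm_one_minus_ii)+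
  have "\<bar>x\<bar> \<le> ?r / \<bar>c\<bar>" using r' c by (simp add: field_simps abs_mult)
  then have "1 + \<bar>x\<bar> \<le> (1 + 1 / \<bar>c\<bar>) * ?r" using r by (simp add: distrib_right)
  then have "(1 + \<bar>x\<bar>) powr q \<le> ((1 + 1 / \<bar>c\<bar>) * ?r) powr q"
    using q by (intro powr_mono2) auto
  also have "\<dots> = (1 + 1 / \<bar>c\<bar>) powr q * ?r powr q"
    using r by (intro powr_mult)
  finally have *: "(1 + \<bar>x\<bar>) powr q \<le> (1 + 1 / \<bar>c\<bar>) powr q * ?r powr q" .
  have "norm (damping N (c * x)) \<le> ?r powr - q"
    unfolding norm_damping using r q by (intro powr_mono) auto
  also have "\<dots> \<le> (1 + 1 / \<bar>c\<bar>) powr q * (1 + \<bar>x\<bar>) powr - q"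
  proof -
    have "?r powr q > 0" "(1 + \<bar>x\<bar>) powr q > 0" using r by auto
    with * show ?thesis by (simp add: powr_minus field_simps)
  qed
  finally show ?thesis .
qed

text \<open>The modulus is |z|^(-Re l) e^(Im l arg z). The first factor decreases in |z|, and |arg
  z| \<le> \<pi> bounds the second.\<close>

lemma norm_powr_minus_le:
  fixes z l :: complex
  assumes l: "Re l \<ge> 0" and r: "0 < r" "r \<le> norm z"
  shows "norm (z powr - l) \<le> r powr - Re l * exp (pi * \<bar>Im l\<bar>)"
proof -
  have z: "z \<noteq> 0" using r by auto
  have "norm (z powr - l) = exp (- Re l * ln (norm z)) * exp (Im l * Im (Ln z))"
    using z by (simp add: powr_def flip: exp_add)
  also have "\<dots> \<le> exp (- Re l * ln r) * exp (pi * \<bar>Im l\<bar>)"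
  proof (intro mult_mono)
    have "Re l * ln r \<le> Re l * ln (norm z)" using l r z by (intro mult_left_mono) auto
    then show "exp (- Re l * ln (norm z)) \<le> exp (- Re l * ln r)" by simp
    have "\<bar>Im (Ln z)\<bar> \<le> pi" using Im_Ln_le_pi[OF z] mpi_less_Im_Ln[OF z] by linarith
    then have "\<bar>Im l * Im (Ln z)\<bar> \<le> \<bar>Im l\<bar> * pi" unfolding abs_mult by (rule mult_left_mono) simp
    then show "exp (Im l * Im (Ln z)) \<le> exp (pi * \<bar>Im l\<bar>)" by (simp add: mult.commute)
  qed auto
  also have "exp (- Re l * ln r) = r powr - Re l" using r by (simp add: powr_def)
  finally show ?thesis .
qed

section \<open>Damped transforms\<close>

lemma weyl_kernel_damped_transform:
  fixes l :: complex and \<omega> \<theta> b z :: real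
  assumes l: "Re l > 0" and \<omega>: "\<omega> \<noteq> 0" and \<theta>: "\<theta> > 0" and N: "N > 0"
    and int: "integrable lborel (\<lambda>s. weyl_kernel l s * (exp (\<i> * of_real (\<omega> * (z - s))) * damping N (\<theta> * \<omega> * (z - s))))"
  shows "(LBINT s. weyl_kernel l s * (exp (\<i> * of_real (\<omega> * (z - s))) * damping N (\<theta> * \<omega> * (z - s)))) =
    (LBINT t. gamma_density N t * (\<i> * of_real (\<omega> * (1 + \<theta> * t))) powr - l * exp (\<i> * of_real (\<omega> * (1 + \<theta> * t) * z)))"
proof -
  define w where "w t = \<omega> * (1 + \<theta> * t)" for t
  \<comment> \<open>The factor e^(-\<eta>s) makes the double integral absolutely convergent; then \<eta> \<rightarrow> 0.\<close>
  define \<eta> where "\<eta> j = inverse (real (Suc j))" for j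
  have \<eta>: "\<eta> j > 0" for j by (simp add: \<eta>_def)
  have \<eta>_lim: "\<eta> \<longlonglongrightarrow> 0" unfolding \<eta>_def by (rule LIMSEQ_inverse_real_of_nat)
  have [measurable]: "w \<in> borel_measurable borel"
    unfolding w_def by measurable
  let ?\<phi> = "\<lambda>x. exp (\<i> * of_real (\<omega> * x)) * damping N (\<theta> * \<omega> * x)"
  let ?B = "\<bar>\<omega>\<bar> powr - Re l * exp (pi * \<bar>Im l\<bar>)"
  have \<phi>: "?\<phi> x = (LBINT t. gamma_density N t * exp (\<i> * of_real (w t * x)))" for x
  proof -
    have "?\<phi> x = (LBINT t. exp (\<i> * of_real (\<omega> * x)) * (gamma_density N t * exp (\<i> * of_real (t * (\<theta> * \<omega> * x)))))"
      using has_bochner_integral_integral_eq[OF damping_fourier[OF N, of "\<theta> * \<omega> * x"]] by simp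
    also have "\<dots> = (LBINT t. gamma_density N t * exp (\<i> * of_real (w t * x)))"
      by (rule Bochner_Integration.integral_cong) (simp_all add: w_def algebra_simps flip: exp_add)
    finally show ?thesis .
  qed
  \<comment> \<open>Here it matters that the frequencies move away from 0: the bound is uniform in t
    and in the regularisation, and it provides the majorant \<open>?B\<close>.\<close>
  have w_le: "\<bar>\<omega>\<bar> \<le> norm (of_real e + \<i> * complex_of_real (w t))" if "t > 0" for e t
  proof -
    have "\<bar>\<omega>\<bar> * 1 \<le> \<bar>\<omega>\<bar> * (1 + \<theta> * t)" using that \<theta> by (intro mult_left_mono) auto
    also have "\<dots> = \<bar>w t\<bar>" using that \<theta> by (simp add: w_def abs_mult)
    also have "\<dots> \<le> norm (of_real e + \<i> * complex_of_real (w t))"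
      using abs_Im_le_cmod[of "of_real e + \<i> * complex_of_real (w t)"] by simp
    finally show ?thesis by simp
  qed
  \<comment> \<open>Apart from convergence, \<eta> moves p = \<eta> + i w(t) into the open right
    half-plane, where \<open>weyl_kernel_Laplace\<close> applies.\<close>
  have regularized: "(LBINT s. weyl_kernel l s * exp (- of_real (\<eta> j * s)) * ?\<phi> (z - s)) =
     (LBINT t. gamma_density N t * ((of_real (\<eta> j) + \<i> * of_real (w t)) powr - l * exp (\<i> * of_real (w t * z))))" for j
  proof -
    have "integrable lborel (\<lambda>s. weyl_kernel l s * exp (- of_real (\<eta> j * s)))"
      using weyl_kernel_Laplace_real[OF l \<eta>] by (simp add: has_bochner_integral_iff)
    then have "(LBINT s. weyl_kernel l s * exp (- of_real (\<eta> j * s)) * ?\<phi> (z - s)) =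
      (LBINT t. gamma_density N t * (LBINT s. weyl_kernel l s * exp (- of_real (\<eta> j * s)) * exp (\<i> * of_real (w t * (z - s)))))"
      unfolding \<phi> by (intro Fubini_bounded_kernel[where B = 1] integrable_gamma_density N) simp_all
    moreover have "(LBINT s. weyl_kernel l s * exp (- of_real (\<eta> j * s)) * exp (\<i> * of_real (w t * (z - s)))) =
        (of_real (\<eta> j) + \<i> * of_real (w t)) powr - l * exp (\<i> * of_real (w t * z))" for t
    proof -
      have "weyl_kernel l s * exp (- of_real (\<eta> j * s)) * exp (\<i> * of_real (w t * (z - s))) =
         exp (\<i> * of_real (w t * z)) * (weyl_kernel l s * exp (- ((of_real (\<eta> j) + \<i> * of_real (w t)) * of_real s)))" for s
        by (simp add: algebra_simps flip: exp_add)
      moreover have "(LBINT s. weyl_kernel l s * exp (- ((of_real (\<eta> j) + \<i> * of_real (w t)) * of_real s))) =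
         (of_real (\<eta> j) + \<i> * of_real (w t)) powr - l"
        using weyl_kernel_Laplace[OF l, of "of_real (\<eta> j) + \<i> * of_real (w t)"] \<eta>[of j]
        by (simp add: has_bochner_integral_iff)
      ultimately show ?thesis by (simp only: integral_mult_right_zero mult.commute)
    qed
    ultimately show ?thesis by (simp only:)
  qed
  have "(\<lambda>j. LBINT s. weyl_kernel l s * exp (- of_real (\<eta> j * s)) * ?\<phi> (z - s)) \<longlonglongrightarrow> (LBINT s. weyl_kernel l s * ?\<phi> (z - s))"
  proof (rule integral_dominated_convergence[where w = "\<lambda>s. norm (weyl_kernel l s * ?\<phi> (z - s))"])
    show "integrable lborel (\<lambda>s. norm (weyl_kernel l s * ?\<phi> (z - s)))" using int by (rule integrable_norm)
    show "AE s in lborel. (\<lambda>j. weyl_kernel l s * exp (- of_real (\<eta> j * s)) * ?\<phi> (z - s)) \<longlonglongrightarrow> weyl_kernel l s * ?\<phi> (z - s)"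
    proof (rule AE_I2)
      fix s
      have "(\<lambda>j. weyl_kernel l s * exp (- of_real (\<eta> j * s)) * ?\<phi> (z - s)) \<longlonglongrightarrow> weyl_kernel l s * exp (- of_real (0 * s)) * ?\<phi> (z - s)"
        by (intro tendsto_intros \<eta>_lim)
      then show "(\<lambda>j. weyl_kernel l s * exp (- of_real (\<eta> j * s)) * ?\<phi> (z - s)) \<longlonglongrightarrow> weyl_kernel l s * ?\<phi> (z - s)" by simp
    qed
    show "AE s in lborel. norm (weyl_kernel l s * exp (- of_real (\<eta> j * s)) * ?\<phi> (z - s)) \<le> norm (weyl_kernel l s * ?\<phi> (z - s))" for j
    proof (rule AE_I2)
      fix s
      show "norm (weyl_kernel l s * exp (- of_real (\<eta> j * s)) * ?\<phi> (z - s)) \<le> norm (weyl_kernel l s * ?\<phi> (z - s))"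
      proof (cases "s > 0")
        case True
        then have "exp (- (\<eta> j * s)) \<le> 1" using \<eta>[of j] by simp
        then have "norm (weyl_kernel l s) * norm (?\<phi> (z - s)) * exp (- (\<eta> j * s)) \<le> norm (weyl_kernel l s) * norm (?\<phi> (z - s)) * 1"
          by (intro mult_left_mono) auto
        then show ?thesis by (simp add: norm_mult mult_ac)
      qed (simp add: weyl_kernel_def)
    qed
  qed measurable
  moreover have "(\<lambda>j. LBINT t. gamma_density N t * ((of_real (\<eta> j) + \<i> * of_real (w t)) powr - l * exp (\<i> * of_real (w t * z)))) \<longlonglongrightarrow>
     (LBINT t. gamma_density N t * ((\<i> * of_real (w t)) powr - l * exp (\<i> * of_real (w t * z))))"
  proof (rule integral_dominated_convergence[where w = "\<lambda>t. norm (gamma_density N t) * ?B"])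
    show "integrable lborel (\<lambda>t. norm (gamma_density N t) * ?B)"
      by (intro integrable_mult_left integrable_norm integrable_gamma_density N)
    show "AE t in lborel. (\<lambda>j. gamma_density N t * ((of_real (\<eta> j) + \<i> * of_real (w t)) powr - l * exp (\<i> * of_real (w t * z))))
       \<longlonglongrightarrow> gamma_density N t * ((\<i> * of_real (w t)) powr - l * exp (\<i> * of_real (w t * z)))"
    proof (rule AE_I2)
      fix t :: real
      show "(\<lambda>j. gamma_density N t * ((of_real (\<eta> j) + \<i> * of_real (w t)) powr - l * exp (\<i> * of_real (w t * z))))
       \<longlonglongrightarrow> gamma_density N t * ((\<i> * of_real (w t)) powr - l * exp (\<i> * of_real (w t * z)))"
      proof (cases "t > 0")
        case True
        \<comment> \<open>The limit point lies on the imaginary axis off 0, hence off the branch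
          cut, and p^(-l) is continuous there.\<close>
        have "\<i> * complex_of_real (w t) \<notin> \<real>\<^sub>\<le>\<^sub>0"
          using w_le[OF True, of 0] \<omega> by (auto simp: complex_nonpos_Reals_iff)
        moreover have "(\<lambda>j. of_real (\<eta> j) + \<i> * of_real (w t)) \<longlonglongrightarrow> of_real 0 + \<i> * complex_of_real (w t)"
          by (intro tendsto_intros \<eta>_lim)
        ultimately show ?thesis by (intro tendsto_intros) auto
      qed (simp add: gamma_density_def weyl_kernel_def)
    qed
    show "AE t in lborel. norm (gamma_density N t * ((of_real (\<eta> j) + \<i> * of_real (w t)) powr - l * exp (\<i> * of_real (w t * z)))) \<le> norm (gamma_density N t) * ?B" for j
    proof (rule AE_I2)
      fix t :: real
      show "norm (gamma_density N t * ((of_real (\<eta> j) + \<i> * of_real (w t)) powr - l * exp (\<i> * of_real (w t * z)))) \<le> norm (gamma_density N t) * ?B"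
      proof (cases "t > 0")
        case True
        have "norm ((of_real (\<eta> j) + \<i> * of_real (w t)) powr - l) \<le> ?B"
          using l \<omega> w_le[OF True] by (intro norm_powr_minus_le) auto
        then show ?thesis by (simp add: norm_mult mult_left_mono)
      qed (simp add: gamma_density_def weyl_kernel_def)
    qed
  qed measurable
  ultimately show ?thesis
    unfolding regularized w_def[symmetric] using LIMSEQ_unique by (fastforce simp: mult.assoc)
qed

lemma tendsto_exp_integral:
  fixes f :: "real \<Rightarrow> complex" and w :: "nat \<Rightarrow> real"
  assumes f: "integrable lborel f" and w: "w \<longlonglongrightarrow> w0"
  shows "(\<lambda>j. LBINT x. f x * exp (\<i> * of_real (w j * x))) \<longlonglongrightarrow> (LBINT x. f x * exp (\<i> * of_real (w0 * x)))"
proof (rule integral_dominated_convergence[OF _ _ integrable_norm[OF f]])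
  note [measurable] = borel_measurable_integrable[OF f]
  show "(\<lambda>x. f x * exp (\<i> * of_real (w0 * x))) \<in> borel_measurable lborel" by measurable
  show "(\<lambda>x. f x * exp (\<i> * of_real (w j * x))) \<in> borel_measurable lborel" for j by measurable
  show "AE x in lborel. (\<lambda>j. f x * exp (\<i> * of_real (w j * x))) \<longlonglongrightarrow> f x * exp (\<i> * of_real (w0 * x))"
    by (intro AE_I2 tendsto_intros w)
qed (simp add: norm_mult)

lemma norm_exp_integral_le:
  fixes f :: "real \<Rightarrow> complex"
  shows "norm (LBINT x. f x * exp (\<i> * of_real (w * x))) \<le> (LBINT x. norm (f x))"
  using integral_norm_bound[of lborel "\<lambda>x. f x * exp (\<i> * of_real (w * x))"] by (simp add: norm_mult)

text \<open>The x-integral has to be moved inside while the unbounded kernel is still present; this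
  is where the decay of the damping and the tail of \<open>f\<close> are spent. Once the inner
  integral has become an average over t, only bounded oscillating factors remain, and t can be moved
  outermost by \<open>Fubini_bounded_kernel\<close>.\<close>

lemma damped_convolution_transform:
  fixes f Q :: "real \<Rightarrow> complex" and l :: complex and \<omega> \<theta> \<delta> \<epsilon> :: real
  assumes l: "Re l > 0" and \<omega>: "\<omega> \<noteq> 0" and \<theta>: "\<theta> > 0" and N: "N > 0" "max (Re l - 1) 0 + 2 \<le> real N"
    and \<delta>: "\<delta> > 0" and \<epsilon>: "\<epsilon> > 0"
    and f: "integrable lborel f"
    and tail: "f \<in> O[at_top](\<lambda>x. complex_of_real (x powr (- Re l - \<epsilon>)))"
    and Q: "integrable lborel Q" and Q_supp: "\<And>\<xi>. \<xi> \<notin> {-1..1} \<Longrightarrow> Q \<xi> = 0"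
  shows "(LBINT x. exp (\<i> * of_real (\<omega> * x)) * damping N (\<theta> * \<omega> * x) *
      (LBINT \<xi>. Q \<xi> * (LBINT y. f y * weyl_kernel l (y - (x + \<delta> * \<xi>))))) =
    (LBINT t. gamma_density N t * ((\<i> * of_real (\<omega> * (1 + \<theta> * t))) powr - l *
       (LBINT y. f y * exp (\<i> * of_real (\<omega> * (1 + \<theta> * t) * y))) *
       (LBINT \<xi>. Q \<xi> * exp (\<i> * of_real (- (\<omega> * (1 + \<theta> * t) * \<delta>) * \<xi>)))))"
proof -
  define b where "b = max (Re l - 1) 0"
  have b0: "b \<ge> 0" by (simp add: b_def)
  define w where "w t = \<omega> * (1 + \<theta> * t)" for t
  have [measurable]: "w \<in> borel_measurable borel"
    unfolding w_def by measurable
  note [measurable] = borel_measurable_integrable[OF Q] borel_measurable_integrable[OF f]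
  define F where "F v = (LBINT y. f y * exp (\<i> * of_real (v * y)))" for v
  have [measurable]: "F \<in> borel_measurable borel"
    unfolding F_def by measurable
  have F_bound: "norm (F v) \<le> (LBINT y. norm (f y))" for v
    unfolding F_def by (rule norm_exp_integral_le)
  define h where "h t = gamma_density N t * (\<i> * of_real (w t)) powr - l" for t
  have [measurable]: "h \<in> borel_measurable borel"
    unfolding h_def by measurable
  let ?\<phi> = "\<lambda>x. exp (\<i> * of_real (\<omega> * x)) * damping N (\<theta> * \<omega> * x)"
  have \<phi>_decay: "norm (?\<phi> x) \<le> (1 + 1 / \<bar>\<theta> * \<omega>\<bar>) powr (b + 2) * (1 + \<bar>x\<bar>) powr (- (b + 2))" for x
    using norm_damping_decay[of "\<theta> * \<omega>" "b + 2" N x] \<theta> \<omega> b0 N by (simp add: norm_mult b_def)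
  have \<phi>_meas: "?\<phi> \<in> borel_measurable borel" by measurable
  from weyl_kernel_damped_bound[OF l b_def \<phi>_meas \<phi>_decay]
  obtain D where D: "D \<ge> 0"
    and k\<phi>: "\<And>z. integrable lborel (\<lambda>s. weyl_kernel l s * ?\<phi> (z - s))"
    and D_bound: "\<And>z. (LBINT s. norm (weyl_kernel l s * ?\<phi> (z - s))) \<le> D * (1 + max z 0) powr b"
    by blast
  have "(LBINT x. ?\<phi> x * (LBINT \<xi>. Q \<xi> * (LBINT y. f y * weyl_kernel l (y - (x + \<delta> * \<xi>))))) =
     (LBINT \<xi>. Q \<xi> * (LBINT y. f y * (LBINT s. weyl_kernel l s * ?\<phi> (y - \<delta> * \<xi> - s))))"
  proof (rule Fubini_convolution[OF \<phi>_meas weyl_kernel_measurable Q f k\<phi> D_bound])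
    fix \<xi> y :: real
    show "norm (Q \<xi>) * (D * (1 + max (y - \<delta> * \<xi>) 0) powr b) \<le>
        norm (Q \<xi>) * (D * (1 + \<delta>) powr b * (1 + max y 0) powr b)"
    proof (cases "\<xi> \<in> {-1..1}")
      case True
      \<comment> \<open>On the support of \<open>Q\<close> the shift \<delta>\<xi> is at most
        \<delta> in size and costs no more than the factor (1 + \<delta>)^b.\<close>
      have "1 + max (y - \<delta> * \<xi>) 0 \<le> (1 + max y 0) * (1 + \<bar>- (\<delta> * \<xi>)\<bar>)"
        using one_plus_max_mult[of y "- (\<delta> * \<xi>)"] by simp
      also have "\<bar>- (\<delta> * \<xi>)\<bar> \<le> \<delta> * 1"
        unfolding abs_minus_cancel abs_mult using True \<delta> by (intro mult_mono) auto
      finally have "1 + max (y - \<delta> * \<xi>) 0 \<le> (1 + max y 0) * (1 + \<delta>)"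
        by (simp add: mult_left_mono)
      then have "(1 + max (y - \<delta> * \<xi>) 0) powr b \<le> ((1 + max y 0) * (1 + \<delta>)) powr b"
        using b0 by (intro powr_mono2) auto
      also have "\<dots> = (1 + \<delta>) powr b * (1 + max y 0) powr b"
        using \<delta> by (subst powr_mult) auto
      finally show ?thesis using D by (simp add: mult_left_mono mult.assoc)
    qed (simp add: Q_supp)
  next
    have "integrable lborel (\<lambda>y. D * (1 + \<delta>) powr b * (norm (f y) * (1 + max y 0) powr b))"
      by (intro integrable_mult_right integrable_weighted_tail[OF f \<epsilon> b_def tail])
    then show "integrable lborel (\<lambda>y. norm (f y) * (D * (1 + \<delta>) powr b * (1 + max y 0) powr b))"
      by (simp add: mult_ac)
  qed
  also have "\<dots> = (LBINT \<xi>. Q \<xi> * (LBINT y. f y * (LBINT t. h t * exp (\<i> * of_real (w t * (y - \<delta> * \<xi>))))))"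
    unfolding weyl_kernel_damped_transform[OF l \<omega> \<theta> N(1) k\<phi>] h_def w_def ..
  finally have transformed: "(LBINT x. ?\<phi> x * (LBINT \<xi>. Q \<xi> * (LBINT y. f y * weyl_kernel l (y - (x + \<delta> * \<xi>))))) =
     (LBINT \<xi>. Q \<xi> * (LBINT y. f y * (LBINT t. h t * exp (\<i> * of_real (w t * (y - \<delta> * \<xi>))))))" .
  have h: "integrable lborel h"
  proof (rule Bochner_Integration.integrable_bound)
    let ?B = "\<bar>\<omega>\<bar> powr - Re l * exp (pi * \<bar>Im l\<bar>)"
    show "integrable lborel (\<lambda>t. gamma_density N t * of_real ?B)"
      by (intro integrable_mult_left integrable_gamma_density N)
    show "AE t in lborel. norm (h t) \<le> norm (gamma_density N t * of_real ?B)"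
    proof (rule AE_I2)
      fix t :: real
      show "norm (h t) \<le> norm (gamma_density N t * of_real ?B)"
      proof (cases "t > 0")
        case True
        have "\<bar>\<omega>\<bar> * 1 \<le> \<bar>\<omega>\<bar> * (1 + \<theta> * t)" using True \<theta> by (intro mult_left_mono) auto
        then have "\<bar>\<omega>\<bar> \<le> \<bar>w t\<bar>" using True \<theta> by (simp add: w_def abs_mult)
        then have "norm ((\<i> * of_real (w t)) powr - l) \<le> ?B"
          using l \<omega> by (intro norm_powr_minus_le) (auto simp: norm_mult)
        then show ?thesis by (simp add: h_def norm_mult mult_left_mono)
      qed (simp add: h_def gamma_density_def weyl_kernel_def)
    qed
  qed measurable
  have swap_y: "(LBINT y. f y * (LBINT t. h t * exp (\<i> * of_real (w t * (y - \<delta> * \<xi>))))) =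
      (LBINT t. h t * (F (w t) * exp (\<i> * of_real (- (w t * \<delta>) * \<xi>))))" for \<xi>
  proof -
    have "(LBINT y. f y * (LBINT t. h t * exp (\<i> * of_real (w t * (y - \<delta> * \<xi>))))) =
       (LBINT t. h t * (LBINT y. f y * exp (\<i> * of_real (w t * (y - \<delta> * \<xi>)))))"
      by (rule Fubini_bounded_kernel[OF f h, where B = 1]) simp_all
    moreover have "(LBINT y. f y * exp (\<i> * of_real (w t * (y - \<delta> * \<xi>)))) = F (w t) * exp (\<i> * of_real (- (w t * \<delta>) * \<xi>))" for t
    proof -
      have "f y * exp (\<i> * of_real (w t * (y - \<delta> * \<xi>))) = f y * exp (\<i> * of_real (w t * y)) * exp (\<i> * of_real (- (w t * \<delta>) * \<xi>))" for y
        by (simp add: algebra_simps flip: exp_add)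
      then show ?thesis unfolding F_def by (simp only: integral_mult_left_zero)
    qed
    ultimately show ?thesis by (simp only:)
  qed
  have swap_\<xi>: "(LBINT \<xi>. Q \<xi> * (LBINT t. h t * (F (w t) * exp (\<i> * of_real (- (w t * \<delta>) * \<xi>))))) =
      (LBINT t. h t * (LBINT \<xi>. Q \<xi> * (F (w t) * exp (\<i> * of_real (- (w t * \<delta>) * \<xi>)))))"
    by (rule Fubini_bounded_kernel[OF Q h, where B = "LBINT y. norm (f y)"])
      (simp_all add: norm_mult F_bound)
  have "h t * (LBINT \<xi>. Q \<xi> * (F (w t) * exp (\<i> * of_real (- (w t * \<delta>) * \<xi>)))) =
     gamma_density N t * ((\<i> * of_real (w t)) powr - l * F (w t) * (LBINT \<xi>. Q \<xi> * exp (\<i> * of_real (- (w t * \<delta>) * \<xi>))))" for t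
    unfolding h_def mult.left_commute[of "Q _"] integral_mult_right_zero by (simp only: mult_ac)
  then show ?thesis
    unfolding transformed swap_y swap_\<xi> by (simp only: F_def w_def)
qed

text \<open>The limit \<theta> \<rightarrow> 0 is taken on both sides. On the left \<open>g\<close>
  itself is the integrable majorant, since the damping has modulus at most 1 and tends to 1. On the
  right the product of transforms is bounded for |v| \<ge> |\<omega>| and continuous at \<omega>,
  and the Gamma density has total mass 1.\<close>

lemma weyl_convolution_transform:
  fixes f Q :: "real \<Rightarrow> complex" and l :: complex and \<omega> \<delta> \<epsilon> :: real
  assumes l: "Re l > 0" and \<omega>: "\<omega> \<noteq> 0" and \<delta>: "\<delta> > 0" and \<epsilon>: "\<epsilon> > 0"
    and f: "integrable lborel f"
    and tail: "f \<in> O[at_top](\<lambda>x. complex_of_real (x powr (- Re l - \<epsilon>)))"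
    and Q: "integrable lborel Q" and Q_supp: "\<And>\<xi>. \<xi> \<notin> {-1..1} \<Longrightarrow> Q \<xi> = 0"
    and g_def: "g = (\<lambda>x. LBINT \<xi>. Q \<xi> * (LBINT y. f y * weyl_kernel l (y - (x + \<delta> * \<xi>))))"
    and g: "integrable lborel g"
  shows "(LBINT x. g x * exp (\<i> * of_real (\<omega> * x))) =
    (\<i> * of_real \<omega>) powr - l * (LBINT y. f y * exp (\<i> * of_real (\<omega> * y))) *
       (LBINT \<xi>. Q \<xi> * exp (\<i> * of_real (- (\<omega> * \<delta>) * \<xi>)))"
proof -
  define N where "N = nat \<lceil>max (Re l - 1) 0 + 2\<rceil>"
  have N: "N > 0" "max (Re l - 1) 0 + 2 \<le> real N" by (auto simp: N_def) linarith+
  define \<theta> where "\<theta> j = inverse (real (Suc j))" for j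
  have \<theta>: "\<theta> j > 0" for j by (simp add: \<theta>_def)
  have \<theta>_lim: "\<theta> \<longlonglongrightarrow> 0" unfolding \<theta>_def by (rule LIMSEQ_inverse_real_of_nat)
  define F where "F v = (LBINT y. f y * exp (\<i> * of_real (v * y)))" for v
  define H where "H v = (LBINT \<xi>. Q \<xi> * exp (\<i> * of_real (v * \<xi>)))" for v
  note [measurable] = borel_measurable_integrable[OF Q] borel_measurable_integrable[OF f] borel_measurable_integrable[OF g]
  have [measurable]: "F \<in> borel_measurable borel" "H \<in> borel_measurable borel"
    unfolding F_def H_def by measurable
  \<comment> \<open>The product expected as the transform at frequency v. The sign in
    \<open>H (- (v * \<delta>))\<close> comes from the evaluation at x + \<delta>\<xi>: a
    translation of the argument by \<delta>\<xi> multiplies the transform by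
    e^(-iv\<delta>\<xi>).\<close>
  define \<Psi> where "\<Psi> v = (\<i> * complex_of_real v) powr - l * F v * H (- (v * \<delta>))" for v
  have [measurable]: "\<Psi> \<in> borel_measurable borel"
    unfolding \<Psi>_def by measurable
  define B where "B = \<bar>\<omega>\<bar> powr - Re l * exp (pi * \<bar>Im l\<bar>) * (LBINT y. norm (f y)) * (LBINT \<xi>. norm (Q \<xi>))"
  have \<Psi>_bound: "norm (\<Psi> v) \<le> B" if v: "\<bar>\<omega>\<bar> \<le> \<bar>v\<bar>" for v
  proof -
    have "norm ((\<i> * complex_of_real v) powr - l) \<le> \<bar>\<omega>\<bar> powr - Re l * exp (pi * \<bar>Im l\<bar>)"
      using l \<omega> v by (intro norm_powr_minus_le) (auto simp: norm_mult)
    then show ?thesis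
      unfolding \<Psi>_def B_def norm_mult F_def H_def
      by (intro mult_mono norm_exp_integral_le mult_nonneg_nonneg integral_nonneg_AE) auto
  qed
  have \<Psi>_lim: "(\<lambda>j. \<Psi> (v j)) \<longlonglongrightarrow> \<Psi> \<omega>" if v: "v \<longlonglongrightarrow> \<omega>" for v
    unfolding \<Psi>_def F_def H_def using \<omega>
    by (intro tendsto_intros tendsto_exp_integral f Q v) (auto simp: complex_nonpos_Reals_iff)
  have "(\<lambda>j. LBINT x. exp (\<i> * of_real (\<omega> * x)) * damping N (\<theta> j * \<omega> * x) * g x) \<longlonglongrightarrow> (LBINT x. g x * exp (\<i> * of_real (\<omega> * x)))"
  proof (rule integral_dominated_convergence[OF _ _ integrable_norm[OF g]])
    show "AE x in lborel. (\<lambda>j. exp (\<i> * of_real (\<omega> * x)) * damping N (\<theta> j * \<omega> * x) * g x) \<longlonglongrightarrow> g x * exp (\<i> * of_real (\<omega> * x))"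
    proof (rule AE_I2)
      fix x
      have "(\<lambda>j. damping N (\<theta> j * \<omega> * x)) \<longlonglongrightarrow> damping N (0 * \<omega> * x)"
        by (rule continuous_on_tendsto_compose[OF continuous_on_damping]) (intro tendsto_intros \<theta>_lim UNIV_I always_eventually allI)+
      then have "(\<lambda>j. exp (\<i> * of_real (\<omega> * x)) * damping N (\<theta> j * \<omega> * x) * g x) \<longlonglongrightarrow> exp (\<i> * of_real (\<omega> * x)) * damping N (0 * \<omega> * x) * g x"
        by (intro tendsto_intros)
      then show "(\<lambda>j. exp (\<i> * of_real (\<omega> * x)) * damping N (\<theta> j * \<omega> * x) * g x) \<longlonglongrightarrow> g x * exp (\<i> * of_real (\<omega> * x))"
        by (simp add: mult.commute)
    qed
    show "AE x in lborel. norm (exp (\<i> * of_real (\<omega> * x)) * damping N (\<theta> j * \<omega> * x) * g x) \<le> norm (g x)" for j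
      by (intro AE_I2) (simp add: norm_mult mult_left_le_one_le norm_damping_le_1)
  qed measurable
  moreover have "(\<lambda>j. LBINT t. gamma_density N t * \<Psi> (\<omega> * (1 + \<theta> j * t))) \<longlonglongrightarrow> (LBINT t. gamma_density N t * \<Psi> \<omega>)"
  proof (rule integral_dominated_convergence)
    show "integrable lborel (\<lambda>t. norm (gamma_density N t) * B)"
      by (intro integrable_mult_left integrable_norm integrable_gamma_density N)
    show "AE t in lborel. (\<lambda>j. gamma_density N t * \<Psi> (\<omega> * (1 + \<theta> j * t))) \<longlonglongrightarrow> gamma_density N t * \<Psi> \<omega>"
    proof (rule AE_I2)
      fix t
      have "(\<lambda>j. \<omega> * (1 + \<theta> j * t)) \<longlonglongrightarrow> \<omega> * (1 + 0 * t)" by (intro tendsto_intros \<theta>_lim)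
      then show "(\<lambda>j. gamma_density N t * \<Psi> (\<omega> * (1 + \<theta> j * t))) \<longlonglongrightarrow> gamma_density N t * \<Psi> \<omega>"
        by (intro tendsto_intros \<Psi>_lim) simp
    qed
    show "AE t in lborel. norm (gamma_density N t * \<Psi> (\<omega> * (1 + \<theta> j * t))) \<le> norm (gamma_density N t) * B" for j
    proof (rule AE_I2)
      fix t :: real
      show "norm (gamma_density N t * \<Psi> (\<omega> * (1 + \<theta> j * t))) \<le> norm (gamma_density N t) * B"
      proof (cases "t > 0")
        case True
        have "\<bar>\<omega>\<bar> * 1 \<le> \<bar>\<omega>\<bar> * (1 + \<theta> j * t)" using True \<theta>[of j] by (intro mult_left_mono) auto
        then have "\<bar>\<omega>\<bar> \<le> \<bar>\<omega> * (1 + \<theta> j * t)\<bar>" using True \<theta>[of j] by (simp add: abs_mult)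
        from \<Psi>_bound[OF this] show ?thesis by (simp add: norm_mult mult_left_mono)
      qed (simp add: gamma_density_def weyl_kernel_def)
    qed
  qed measurable
  moreover have "(LBINT x. exp (\<i> * of_real (\<omega> * x)) * damping N (\<theta> j * \<omega> * x) * g x) = (LBINT t. gamma_density N t * \<Psi> (\<omega> * (1 + \<theta> j * t)))" for j
    unfolding g_def \<Psi>_def F_def H_def
    by (rule damped_convolution_transform[OF l \<omega> \<theta> N \<delta> \<epsilon> f tail Q Q_supp])
  ultimately have "(LBINT x. g x * exp (\<i> * of_real (\<omega> * x))) = (LBINT t. gamma_density N t * \<Psi> \<omega>)"
    using LIMSEQ_unique by simp
  then show ?thesis
    by (simp add: integral_gamma_density[OF N(1)] \<Psi>_def F_def H_def)
qed

section \<open>Assembling the transfer function\<close>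

theorem mainTheorem3:
  fixes n :: nat and \<alpha> \<beta> \<delta> \<epsilon> :: real and \<nu> :: complex and f g F G :: "real \<Rightarrow> complex"
  assumes "n > 0" and "\<alpha> > -1" and "\<beta> > -1" and "\<delta> > 0" and "Re \<nu> < real n"
    and "continuous_on UNIV f" and "integrable lborel f"
    and "\<epsilon> > 0" and "f \<in> O[at_top](\<lambda>x. complex_of_real (x powr (Re \<nu> - real n - \<epsilon>)))"
    and "g = approx_frac_jacobi_deriv \<delta> \<alpha> \<beta> \<nu> n f"
    and "integrable lborel g"
    and "F = fourier_transform f" and "G = fourier_transform g"
  shows "\<forall>\<omega>. \<omega> \<noteq> 0 \<longrightarrow> G \<omega> = jacobi_transfer \<delta> \<alpha> \<beta> \<nu> n \<omega> * F \<omega>"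
proof (intro allI impI)
  fix \<omega> :: real
  assume \<omega>: "\<omega> \<noteq> 0"
  define l where "l = of_nat n - \<nu>"
  define c where "c = (- 1) ^ n * complex_of_real (lead_coeff (jacobi_poly \<alpha> \<beta> n) * fact n / jacobi_norm \<alpha> \<beta> n * (1 / \<delta> ^ n))"
  \<comment> \<open>All constants, the sign (-1)^n of the fractional derivative and the prefactor of
    \<open>approx_jacobi_deriv\<close>, are absorbed into the kernel, so that g takes the form
    treated in \<open>weyl_convolution_transform\<close>.\<close>
  define Q where "Q \<xi> = c * complex_of_real (jacobi_kernel \<alpha> \<beta> n \<xi>)" for \<xi>
  have l: "Re l > 0" using assms(5) by (simp add: l_def)
  have tail: "f \<in> O[at_top](\<lambda>x. complex_of_real (x powr (- Re l - \<epsilon>)))"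
    using assms(9) by (simp add: l_def)
  have Q: "integrable lborel Q"
    unfolding Q_def by (intro integrable_mult_right integrable_of_real integrable_jacobi_kernel assms)
  have Q_supp: "Q \<xi> = 0" if "\<xi> \<notin> {-1..1}" for \<xi>
    using that by (simp add: Q_def jacobi_kernel_def)
  have weyl: "weyl_integral l f x = (LBINT y. f y * weyl_kernel l (y - x))" for x
    unfolding weyl_integral_def set_lebesgue_integral_def integral_mult_right_zero[symmetric]
    by (rule Bochner_Integration.integral_cong) (auto simp: weyl_kernel_def indicator_def)
  have g_eq: "g = (\<lambda>x. LBINT \<xi>. Q \<xi> * (LBINT y. f y * weyl_kernel l (y - (x + \<delta> * \<xi>))))"
  proof
    fix x
    have "g x = c * (LBINT \<xi>:{-1..1}. weyl_integral l f (x + \<delta> * \<xi>) *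
        of_real (poly (jacobi_poly \<alpha> \<beta> n) \<xi> * jacobi_weight \<alpha> \<beta> \<xi>))"
      unfolding assms(10) approx_frac_jacobi_deriv_def approx_jacobi_deriv_def c_def l_def by (simp only: mult.assoc)
    also have "\<dots> = (LBINT \<xi>. Q \<xi> * weyl_integral l f (x + \<delta> * \<xi>))"
      unfolding set_lebesgue_integral_def integral_mult_right_zero[symmetric]
      by (rule Bochner_Integration.integral_cong) (auto simp: Q_def jacobi_kernel_def indicator_def)
    finally show "g x = (LBINT \<xi>. Q \<xi> * (LBINT y. f y * weyl_kernel l (y - (x + \<delta> * \<xi>))))"
      unfolding weyl .
  qed
  have iw: "\<i> * complex_of_real \<omega> \<noteq> 0" using \<omega> by simp
  have "(LBINT \<xi>. Q \<xi> * exp (\<i> * of_real (- (\<omega> * \<delta>) * \<xi>))) =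
     c * (LBINT \<xi>. exp (- \<i> * of_real (\<omega> * \<delta> * \<xi>)) * of_real (jacobi_kernel \<alpha> \<beta> n \<xi>))"
    unfolding integral_mult_right_zero[symmetric] by (simp add: Q_def mult_ac)
  also have "\<dots> = (\<i> * of_real \<omega>) ^ n * (exp (- \<i> * of_real (\<omega> * \<delta>)) *
     kummer_M (of_real (real n + \<alpha> + 1)) (of_real (2 * real n + \<alpha> + \<beta> + 2)) (2 * \<i> * of_real (\<omega> * \<delta>)))"
    unfolding c_def jacobi_kernel_multiplier[OF assms(2,3,4) \<omega>] by (rule mult.assoc)
  \<comment> \<open>Since n = \<nu> + l and all powers share one nonzero base, the exponents add
    without a branch correction. The power l then cancels the Laplace factor (i\<omega>)^(-l), and
    (i\<omega>)^\<nu> remains.\<close>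
  also have "(\<i> * complex_of_real \<omega>) ^ n = (\<i> * of_real \<omega>) powr \<nu> * (\<i> * of_real \<omega>) powr l"
    using iw by (simp add: l_def powr_nat' flip: powr_add)
  finally have "(\<i> * of_real \<omega>) powr - l * (LBINT \<xi>. Q \<xi> * exp (\<i> * of_real (- (\<omega> * \<delta>) * \<xi>))) =
     ((\<i> * of_real \<omega>) powr - l * (\<i> * of_real \<omega>) powr l) * jacobi_transfer \<delta> \<alpha> \<beta> \<nu> n \<omega>"
    unfolding jacobi_transfer_def by (simp only: mult_ac)
  also have "(\<i> * complex_of_real \<omega>) powr - l * (\<i> * of_real \<omega>) powr l = 1"
    using iw by (simp flip: powr_add)
  finally have transfer: "(\<i> * of_real \<omega>) powr - l * (LBINT \<xi>. Q \<xi> * exp (\<i> * of_real (- (\<omega> * \<delta>) * \<xi>))) =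
     jacobi_transfer \<delta> \<alpha> \<beta> \<nu> n \<omega>" by simp
  have "(LBINT x. g x * exp (\<i> * of_real (\<omega> * x))) =
     jacobi_transfer \<delta> \<alpha> \<beta> \<nu> n \<omega> * (LBINT y. f y * exp (\<i> * of_real (\<omega> * y)))"
  proof -
    have "(LBINT x. g x * exp (\<i> * of_real (\<omega> * x))) =
      (\<i> * of_real \<omega>) powr - l * (LBINT y. f y * exp (\<i> * of_real (\<omega> * y))) *
       (LBINT \<xi>. Q \<xi> * exp (\<i> * of_real (- (\<omega> * \<delta>) * \<xi>)))"
      by (rule weyl_convolution_transform[OF l \<omega> assms(4,8,7) tail Q _ g_eq assms(11)]) (rule Q_supp)
    then show ?thesis
      unfolding transfer[symmetric] by (simp only: mult_ac)
  qed
  then show "G \<omega> = jacobi_transfer \<delta> \<alpha> \<beta> \<nu> n \<omega> * F \<omega>"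
    unfolding assms(12,13) fourier_transform_def by (simp only: mult_ac)
qed

end
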